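(* For every ordinal $\alpha<\omega\cdot\omega$, the compact space $$\mathcal{H}_\alpha=\{f:\{0,1\}^\alpha\to[0,1] : \text{for all } x,y\in\{0,1\}^\alpha,\ x\prec y\Rightarrow f(x)\le f(y)\},$$ endowed with the topology of pointwise convergence, is (homeomorphic to) a subspace of a continuous image of a separable Rosenthal compact space in the class $\mathcal{CD}$.
   Context: $\prec$ is the lexicographic order on $\{0,1\}^\alpha$: $x\prec y$ iff $x\neq y$ and $x_\beta<y_\beta$ for the first ordinal $\beta<\alpha$ at which $x_\beta\neq y_\beta$. A compact space $K$ is Rosenthal if it is homeomorphic to a set of functions $f:X\to\mathbb{R}$ of the first Baire class on some Polish space $X$, compact in the topology of pointwise convergence. A compact space $K$ belongs to the class $\mathcal{CD}$ if it is homeomorphic to a pointwise compact set of functions $f:X\to\mathbb{R}$, each with at most countably many discontinuities, on some compact metric space $X$. *)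

theory Defs
  imports "HOL-Analysis.Analysis"
begin

text \<open>The ordinal \<open>\<omega> \<cdot> \<omega>\<close>: \<open>\<omega>\<close> consecutive copies of \<open>\<omega>\<close>, the first component numbering
  the copy. An ordinal \<open>\<alpha>\<close> is represented by a (reflexive) well-order \<open>r\<close> of that type; its
  elements are those of \<open>Field r\<close>, so \<open>\<alpha> = 0\<close> is the empty relation.\<close>

definition omega_times_omega :: "(nat \<times> nat) rel" where
  "omega_times_omega = (less_than <*lex*> less_than)\<^sup>="

lemma omega_times_omega_iff:
  "((a, b), (c, d)) \<in> omega_times_omega \<longleftrightarrow> a < c \<or> (a = c \<and> b \<le> d)"
  unfolding omega_times_omega_def by auto

lemma Well_order_omega_times_omega: "Well_order omega_times_omega"
proof -
  have F: "Field omega_times_omega = UNIV"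
    unfolding omega_times_omega_def by (auto simp: Field_def)
  have "refl omega_times_omega"
    unfolding omega_times_omega_def refl_on_def by auto
  moreover have "trans omega_times_omega"
    by (rule transI) (auto simp: omega_times_omega_iff)
  moreover have "antisym omega_times_omega"
    by (rule antisymI) (auto simp: omega_times_omega_iff)
  moreover have "total omega_times_omega"
    by (auto simp: total_on_def omega_times_omega_iff)
  moreover have "wf (omega_times_omega - Id)"
    by (rule wf_subset[of "less_than <*lex*> less_than"])
      (auto simp: omega_times_omega_def intro: wf_lex_prod)
  ultimately show ?thesis
    unfolding well_order_on_def linear_order_on_def partial_order_on_def preorder_on_def F
    by auto
qed

definition cube :: "'a rel \<Rightarrow> ('a \<Rightarrow> nat) set" where
  "cube r = (Field r \<rightarrow>\<^sub>E {0, 1})"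

text \<open>\<^term>\<open>underS r b\<close> is the set of elements strictly below \<open>b\<close>, so \<open>b\<close> below is the first
  element at which \<open>x\<close> and \<open>y\<close> differ.\<close>

definition lex_less :: "'a rel \<Rightarrow> ('a \<Rightarrow> nat) \<Rightarrow> ('a \<Rightarrow> nat) \<Rightarrow> bool" where
  "lex_less r x y \<longleftrightarrow> (\<exists>b\<in>Field r. (\<forall>c\<in>underS r b. x c = y c) \<and> x b < y b)"

definition monotone_functions :: "'a rel \<Rightarrow> (('a \<Rightarrow> nat) \<Rightarrow> real) set" where
  "monotone_functions r =
     {f \<in> cube r \<rightarrow>\<^sub>E {0..1}. \<forall>x\<in>cube r. \<forall>y\<in>cube r. lex_less r x y \<longrightarrow> f x \<le> f y}"

definition H_space :: "'a rel \<Rightarrow> (('a \<Rightarrow> nat) \<Rightarrow> real) topology" where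
  "H_space r = subtopology (product_topology (\<lambda>_. euclideanreal) (cube r)) (monotone_functions r)"

text \<open>Real functions on \<open>X\<close> with the topology of pointwise convergence; as everywhere here,
  functions take the value \<^const>\<open>undefined\<close> outside their domain.\<close>

definition pointwise_topology :: "'a topology \<Rightarrow> ('a \<Rightarrow> real) topology" where
  "pointwise_topology X = product_topology (\<lambda>_. euclideanreal) (topspace X)"

definition Polish_space :: "'a topology \<Rightarrow> bool" where
  "Polish_space X \<longleftrightarrow> completely_metrizable_space X \<and> separable_space X"

definition first_Baire_class :: "'a topology \<Rightarrow> ('a \<Rightarrow> real) \<Rightarrow> bool" where
  "first_Baire_class X f \<longleftrightarrow>
     (\<exists>g :: nat \<Rightarrow> 'a \<Rightarrow> real. (\<forall>n. continuous_map X euclideanreal (g n)) \<and>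
        (\<forall>x\<in>topspace X. (\<lambda>n. g n x) \<longlonglongrightarrow> f x))"

definition discontinuities :: "'a topology \<Rightarrow> ('a \<Rightarrow> real) \<Rightarrow> 'a set" where
  "discontinuities X f = {x \<in> topspace X. \<not> topcontinuous_at X euclideanreal f x}"

text \<open>A definition cannot quantify over the carrier type of \<open>X\<close>. In the next two definitions \<open>X\<close>
  is an arbitrary topology on an arbitrary subset of \<^typ>\<open>nat \<Rightarrow> real\<close>, not necessarily related to
  the topology of that type. This is no restriction: Polish and compact metric spaces have
  cardinality at most that of the continuum, so each has a homeomorphic copy of this form.\<close>

definition Rosenthal_compact :: "'k topology \<Rightarrow> bool" where
  "Rosenthal_compact K \<longleftrightarrow> compact_space K \<and>
     (\<exists>(X :: (nat \<Rightarrow> real) topology) F. Polish_space X \<and>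
        compactin (pointwise_topology X) F \<and>
        (\<forall>f\<in>F. first_Baire_class X f) \<and>
        K homeomorphic_space subtopology (pointwise_topology X) F)"

definition class_CD :: "'k topology \<Rightarrow> bool" where
  "class_CD K \<longleftrightarrow> compact_space K \<and>
     (\<exists>(X :: (nat \<Rightarrow> real) topology) F. compact_space X \<and> metrizable_space X \<and>
        compactin (pointwise_topology X) F \<and>
        (\<forall>f\<in>F. countable (discontinuities X f)) \<and>
        K homeomorphic_space subtopology (pointwise_topology X) F)"

text \<open>Compact spaces are Hausdorff by convention; for \<open>K\<close> this follows from
  \<^term>\<open>Rosenthal_compact K\<close>, for the image \<open>L\<close> it has to be required. Fixing the carrier types is
  no restriction: \<open>K\<close> is homeomorphic to a set of functions of type \<^typ>\<open>(nat \<Rightarrow> real) \<Rightarrow> real\<close>,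
  and \<open>L\<close>, being an image of \<open>K\<close>, has at most as many points.\<close>

definition subspace_of_image_of_separable_Rosenthal_CD :: "'h topology \<Rightarrow> bool" where
  "subspace_of_image_of_separable_Rosenthal_CD H \<longleftrightarrow>
     (\<exists>(K :: ((nat \<Rightarrow> real) \<Rightarrow> real) topology) (L :: ((nat \<Rightarrow> real) \<Rightarrow> real) topology) g S.
        separable_space K \<and> Rosenthal_compact K \<and> class_CD K \<and>
        Hausdorff_space L \<and> continuous_map K L g \<and> g ` topspace K = topspace L \<and>
        S \<subseteq> topspace L \<and> H homeomorphic_space subtopology L S)"

end

theory Submission
  imports Defs
begin

text \<open>The compact space that works for every \<open>\<alpha>\<close> is the Helly space of increasing functions
  \<open>[0,1] \<rightarrow> [0,1]\<close>. It is separable, its elements are of the first Baire class, and they have countably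
  many discontinuities. The claim thus follows once \<open>\<H>\<^sub>\<alpha>\<close> is a continuous image of a closed
  subset \<open>C\<close> of the Helly space, since the map on \<open>C\<close> extends to the whole space by Tietze's theorem
  (\<open>subspace_of_image_increasing_space\<close>). Call such spaces Helly images.

  The countable power of the Helly space is a Helly image: an increasing function that maps each of
  countably many disjoint intervals into itself restricts to an arbitrary sequence of increasing
  functions on these intervals (\<open>helly_image_helly_power\<close>). Hence Helly images are closed under countable products, besides
  continuous images and closed subspaces.

  Every \<open>\<alpha> < \<omega> \<cdot> \<omega>\<close> is of the form \<open>\<omega> \<cdot> n + m\<close>, and the proof is by induction on \<open>n\<close>. For \<open>n = 0\<close> the
  cube is finite. For the step, the cube \<open>{0,1}\<^sup>\<alpha>\<close> with \<open>\<alpha> = \<omega> + \<beta>\<close> is the lexicographic product \<open>T \<times> B\<close> of a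
  copy \<open>T\<close> of the Cantor set in \<open>[0,1]\<close> with the cube \<open>B\<close> of exponent \<open>\<beta>\<close>. An increasing function on the product is
  described by its infima and suprema on the fibres over \<open>T\<close>, which are increasing functions on \<open>T\<close>, and by one
  increasing function on \<open>B\<close> for each fibre with a positive jump. As the jumps sum up to at most \<open>1\<close>,
  these fibres can be listed with the \<open>n\<close>-th jump at most \<open>1 / (n + 1)\<close>. Countably many
  elements of Helly images thus describe the function. The admissible descriptions, with the bounds on
  the jumps built in, form a closed set, and these bounds make the recovery of the function continuous
  (\<open>helly_image_lex_product\<close>).\<close>

section \<open>Interpolating increasing real functions\<close>

text \<open>The interpolant is the lower envelope of ramps that start at height \<open>u p\<close> in \<open>p\<close> and rise to
  the right. When the common slope is at least every slope of \<open>u\<close> on \<open>P\<close>, no ramp passes below a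
  point of the graph of \<open>u\<close>; increasing ramps make the envelope increasing.\<close>

lemma monotone_continuous_interpolation:
  fixes u :: "real \<Rightarrow> real"
  assumes fin: "finite P" and ne: "P \<noteq> {}" and mono: "mono_on P u"
  shows "\<exists>g. continuous_on UNIV g \<and> mono g \<and> (\<forall>p\<in>P. g p = u p)"
proof -
  define L where "L = Max ((\<lambda>(p, q). (u q - u p) / (q - p)) ` (P \<times> P))"
  \<comment> \<open>The pair with equal entries has slope \<open>0 / 0 = 0\<close>, which is why the maximum is nonnegative.\<close>
  have slope: "(u q - u p) / (q - p) \<le> L" if "p \<in> P" "q \<in> P" for p q
    unfolding L_def using fin that by (intro Max_ge) (auto intro: rev_image_eqI)
  have L0: "0 \<le> L"
    using ne slope by fastforce
  define h where "h p x = u p + L * max 0 (x - p)" for p x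
  define g where "g x = Min ((\<lambda>p. h p x) ` P)" for x
  have g_le: "g x \<le> h p x" if "p \<in> P" for p x
    unfolding g_def using fin that by (intro Min_le) auto
  have g_in: "\<exists>p\<in>P. g x = h p x" for x
  proof -
    have "g x \<in> (\<lambda>p. h p x) ` P" unfolding g_def using fin ne by (intro Min_in) auto
    then show ?thesis by blast
  qed
  have "continuous_on UNIV g"
  proof -
    have "continuous_on UNIV (\<lambda>x. Min ((\<lambda>p. h p x) ` P))"
      using fin ne
    proof (induction rule: finite_ne_induct)
      case (singleton p)
      then show ?case by (simp add: h_def) (intro continuous_intros)
    next
      case (insert p P)
      have "continuous_on UNIV (\<lambda>x. min (h p x) (Min ((\<lambda>p. h p x) ` P)))"
        by (intro continuous_on_min insert.IH) (auto simp: h_def intro!: continuous_intros)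
      then show ?case using insert.hyps by simp
    qed
    then show ?thesis by (simp add: g_def[abs_def])
  qed
  moreover have "mono g"
  proof (rule monoI)
    fix x y :: real assume "x \<le> y"
    obtain p where p: "p \<in> P" "g y = h p y" using g_in by blast
    have "h p x \<le> h p y"
      unfolding h_def using L0 \<open>x \<le> y\<close> by (intro add_left_mono mult_left_mono) auto
    then show "g x \<le> g y" using g_le[OF p(1), of x] p(2) by simp
  qed
  moreover have "g q = u q" if q: "q \<in> P" for q
  proof (rule antisym)
    show "g q \<le> u q" using g_le[OF q, of q] by (simp add: h_def)
    obtain p where p: "p \<in> P" "g q = h p q" using g_in by blast
    have "u q \<le> h p q"
    proof (cases "q \<le> p")
      case True
      then show ?thesis using mono p(1) q by (simp add: h_def mono_on_def)
    next
      case False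
      then have "u q - u p \<le> L * (q - p)"
        using slope[OF p(1) q] by (simp add: field_simps)
      then show ?thesis using False by (simp add: h_def)
    qed
    then show "u q \<le> g q" using p(2) by simp
  qed
  ultimately show ?thesis by blast
qed

text \<open>A finite set of pairs of a breakpoint and a height codes an increasing step function; the codes with
  rational entries are countable in number, and approximate all increasing functions.\<close>

definition step_function :: "(real \<times> real) set \<Rightarrow> real \<Rightarrow> real" where
  "step_function A t = Max (insert 0 (snd ` {a \<in> A. fst a \<le> t}))"

lemma step_function_mono:
  assumes "finite A" "s \<le> t"
  shows "step_function A s \<le> step_function A t"
  unfolding step_function_def using assms by (intro Max_mono) auto

lemma step_function_bounds:
  assumes "finite A" "snd ` A \<subseteq> {0..1}"
  shows "step_function A t \<in> {0..1}"
proof -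
  have "step_function A t \<in> insert 0 (snd ` {a \<in> A. fst a \<le> t})"
    unfolding step_function_def using assms by (intro Max_in) auto
  then show ?thesis using assms(2) by auto
qed

text \<open>Below each point \<open>t\<close> of \<open>T\<close> a rational breakpoint is put after all smaller points of \<open>T\<close>, with a
  rational height just below \<open>u t\<close>. The breakpoints passed at \<open>t\<close> are then those of the points up to
  \<open>t\<close>, whose heights are at most \<open>u t\<close> because \<open>u\<close> increases. There are only countably many such
  step functions, which gives the separability of the Helly space.\<close>

lemma step_function_approximation:
  fixes u :: "real \<Rightarrow> real"
  assumes fin: "finite T" and mono: "mono_on T u" and u01: "u ` T \<subseteq> {0..1}" and e: "0 < e"
  shows "\<exists>A. finite A \<and> A \<subseteq> \<rat> \<times> (\<rat> \<inter> {0..1}) \<and> (\<forall>t\<in>T. \<bar>step_function A t - u t\<bar> < e)"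
proof -
  have "\<exists>q\<in>\<rat>. q \<le> t \<and> (\<forall>s\<in>T. s < t \<longrightarrow> s < q)" if "t \<in> T" for t
  proof -
    let ?m = "Max (insert (t - 1) {s \<in> T. s < t})"
    have "?m \<in> insert (t - 1) {s \<in> T. s < t}" using fin by (intro Max_in) auto
    then have "?m < t" by auto
    then obtain q where q: "q \<in> \<rat>" "?m < q" "q < t" using Rats_dense_in_real by blast
    have "s < q" if "s \<in> T" "s < t" for s
    proof -
      have "s \<le> ?m" using fin that by (intro Max_ge) auto
      then show ?thesis using q by simp
    qed
    then show ?thesis using q by (intro bexI[of _ q]) auto
  qed
  then obtain q where q: "\<And>t. t \<in> T \<Longrightarrow> q t \<in> \<rat> \<and> q t \<le> t \<and> (\<forall>s\<in>T. s < t \<longrightarrow> s < q t)"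
    by metis
  have "\<exists>v\<in>\<rat>. 0 \<le> v \<and> v \<le> u t \<and> u t - e < v" if "t \<in> T" for t
  proof (cases "u t = 0")
    case True
    then show ?thesis using e by (intro bexI[of _ 0]) auto
  next
    case False
    then have "max 0 (u t - e) < u t" using that u01 e by fastforce
    then obtain v where v: "v \<in> \<rat>" "max 0 (u t - e) < v" "v < u t"
      using Rats_dense_in_real by blast
    then show ?thesis by (intro bexI[of _ v]) auto
  qed
  then obtain v where v: "\<And>t. t \<in> T \<Longrightarrow> v t \<in> \<rat> \<and> 0 \<le> v t \<and> v t \<le> u t \<and> u t - e < v t"
    by metis
  let ?A = "(\<lambda>t. (q t, v t)) ` T"
  have "\<bar>step_function ?A t - u t\<bar> < e" if t: "t \<in> T" for t
  proof -
    let ?V = "insert 0 (snd ` {a \<in> ?A. fst a \<le> t})"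
    have "v t \<le> Max ?V" using fin q t by (intro Max_ge) (auto intro!: rev_image_eqI)
    moreover have "Max ?V \<le> u t"
    proof (rule Max.boundedI)
      fix w assume "w \<in> ?V"
      then consider "w = 0" | s where "s \<in> T" "q s \<le> t" "w = v s" by auto
      then show "w \<le> u t"
      proof cases
        case 1
        then show ?thesis using u01 t by auto
      next
        case 2
        then have "s \<le> t" using q[of s] t by fastforce
        then have "u s \<le> u t" using mono 2 t by (simp add: mono_on_def)
        then show ?thesis using v[of s] 2 by simp
      qed
    qed (use fin in auto)
    ultimately show ?thesis using v[OF t] by (simp add: step_function_def)
  qed
  moreover have "?A \<subseteq> \<rat> \<times> (\<rat> \<inter> {0..1})" using q v u01 by fastforce
  ultimately show ?thesis using fin by blast
qed

section \<open>The Helly space\<close>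

text \<open>A copy of \<open>[0,1]\<close> inside \<^typ>\<open>nat \<Rightarrow> real\<close>, namely the constant sequences. The Helly space
  consists of the increasing functions on it, and \<open>helly_of\<close> carries functions of a real variable over
  to it.\<close>

definition unit_segment :: "(nat \<Rightarrow> real) topology" where
  "unit_segment = top_of_set ((\<lambda>t _. t) ` {0..1})"

definition helly_functions :: "((nat \<Rightarrow> real) \<Rightarrow> real) set" where
  "helly_functions = {f \<in> topspace unit_segment \<rightarrow>\<^sub>E {0..1}.
     \<forall>s\<in>{0..1}. \<forall>t\<in>{0..1}. s \<le> t \<longrightarrow> f (\<lambda>_. s) \<le> f (\<lambda>_. t)}"

definition helly_space :: "((nat \<Rightarrow> real) \<Rightarrow> real) topology" where
  "helly_space = subtopology (pointwise_topology unit_segment) helly_functions"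

definition helly_of :: "(real \<Rightarrow> real) \<Rightarrow> (nat \<Rightarrow> real) \<Rightarrow> real" where
  "helly_of u = (\<lambda>z\<in>topspace unit_segment. u (z 0))"

lemma topspace_unit_segment: "topspace unit_segment = (\<lambda>t _. t) ` {0..1}"
  by (simp add: unit_segment_def)

lemma const_in_unit_segment [simp]: "(\<lambda>_. t) \<in> topspace unit_segment \<longleftrightarrow> t \<in> {0..1}"
  by (auto simp: topspace_unit_segment fun_eq_iff image_iff)

lemma topspace_helly_space [simp]: "topspace helly_space = helly_functions"
  by (auto simp: helly_space_def pointwise_topology_def helly_functions_def PiE_def Pi_def)

lemma helly_functions_bounds:
  "f \<in> helly_functions \<Longrightarrow> t \<in> {0..1} \<Longrightarrow> f (\<lambda>_. t) \<in> {0..1}"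
  unfolding helly_functions_def using const_in_unit_segment by (blast dest: PiE_mem)

lemma helly_functions_mono:
  "f \<in> helly_functions \<Longrightarrow> 0 \<le> s \<Longrightarrow> s \<le> t \<Longrightarrow> t \<le> 1 \<Longrightarrow> f (\<lambda>_. s) \<le> f (\<lambda>_. t)"
  by (auto simp: helly_functions_def)

lemma helly_of_const [simp]: "t \<in> {0..1} \<Longrightarrow> helly_of u (\<lambda>_. t) = u t"
  by (simp add: helly_of_def)

lemma helly_of_in_helly_functions:
  assumes "\<And>t. t \<in> {0..1} \<Longrightarrow> u t \<in> {0..1}" "mono_on {0..1} u"
  shows "helly_of u \<in> helly_functions"
  using assms by (auto simp: helly_functions_def helly_of_def topspace_unit_segment mono_on_def)

text \<open>The points \<open>e i\<close> may form any subset of \<open>[0,1]\<close>: an increasing function on a subset extends by taking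
  suprema from the left. All elements of the Helly space with prescribed values come from here.\<close>

lemma helly_interpolation:
  fixes e v :: "'i \<Rightarrow> real"
  assumes e: "\<And>i. i \<in> A \<Longrightarrow> e i \<in> {0..1}" and v: "\<And>i. i \<in> A \<Longrightarrow> v i \<in> {0..1}"
    and mono: "\<And>i j. i \<in> A \<Longrightarrow> j \<in> A \<Longrightarrow> e i \<le> e j \<Longrightarrow> v i \<le> v j"
  shows "\<exists>f\<in>helly_functions. \<forall>i\<in>A. f (\<lambda>_. e i) = v i"
proof
  define V where "V t = insert 0 (v ` {i \<in> A. e i \<le> t})" for t
  define u where "u t = Sup (V t)" for t
  have bd: "bdd_above (V t)" for t
    using v by (intro bdd_aboveI[of _ 1]) (auto simp: V_def)
  have ne: "V t \<noteq> {}" for t by (simp add: V_def)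
  show "helly_of u \<in> helly_functions"
  proof (rule helly_of_in_helly_functions)
    fix t :: real
    have "0 \<le> u t" unfolding u_def using bd by (intro cSup_upper) (auto simp: V_def)
    moreover have "u t \<le> 1" unfolding u_def using ne v by (intro cSup_least) (auto simp: V_def)
    ultimately show "u t \<in> {0..1}" by simp
  next
    show "mono_on {0..1} u"
      unfolding u_def by (intro mono_onI cSup_subset_mono ne bd) (auto simp: V_def)
  qed
  show "\<forall>i\<in>A. helly_of u (\<lambda>_. e i) = v i"
  proof
    fix i assume i: "i \<in> A"
    have "u (e i) = v i"
      unfolding u_def
    proof (rule cSup_eq_maximum)
      show "v i \<in> V (e i)" using i by (auto simp: V_def)
      show "w \<le> v i" if "w \<in> V (e i)" for w using that v[OF i] mono i by (auto simp: V_def)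
    qed
    then show "helly_of u (\<lambda>_. e i) = v i" using e[OF i] by simp
  qed
qed

subsection \<open>Compactness\<close>

lemma continuous_map_helly_eval:
  "t \<in> {0..1} \<Longrightarrow> continuous_map helly_space euclideanreal (\<lambda>f. f (\<lambda>_. t))"
  unfolding helly_space_def pointwise_topology_def
  by (intro continuous_map_from_subtopology continuous_map_product_projection) simp

text \<open>The sets of codes below are cut out by inequalities between continuous real functions, combined by
  conjunctions, finite disjunctions and universal quantifiers. The following rules show the closedness
  of such sets syntactically.\<close>

lemma closedin_Collect_le:
  fixes f g :: "'x \<Rightarrow> real"
  assumes "continuous_map X euclideanreal f" "continuous_map X euclideanreal g"
  shows "closedin X {x \<in> topspace X. f x \<le> g x}"
proof -
  have "closedin X {x \<in> topspace X. g x - f x \<in> {0..}}"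
    by (intro closedin_continuous_map_preimage[where Y = euclideanreal] continuous_map_diff assms) simp
  then show ?thesis by simp
qed

lemma closedin_Collect_eq:
  fixes f g :: "'x \<Rightarrow> real"
  assumes "continuous_map X euclideanreal f" "continuous_map X euclideanreal g"
  shows "closedin X {x \<in> topspace X. f x = g x}"
proof -
  have "{x \<in> topspace X. f x = g x} = {x \<in> topspace X. f x \<le> g x} \<inter> {x \<in> topspace X. g x \<le> f x}"
    by auto
  then show ?thesis
    using closedin_Int[OF closedin_Collect_le[OF assms] closedin_Collect_le[OF assms(2,1)]] by simp
qed

lemma closedin_Collect_all:
  assumes "\<And>i. closedin X {x \<in> topspace X. P i x}"
  shows "closedin X {x \<in> topspace X. \<forall>i. P i x}"
proof -
  have "{x \<in> topspace X. \<forall>i. P i x} = (\<Inter>i. {x \<in> topspace X. P i x})" by auto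
  then show ?thesis using assms by (auto intro!: closedin_Inter)
qed

lemma closedin_Collect_imp:
  assumes "P \<Longrightarrow> closedin X {x \<in> topspace X. Q x}"
  shows "closedin X {x \<in> topspace X. P \<longrightarrow> Q x}"
  using assms by (cases P) auto

lemma closedin_Collect_conj:
  assumes "closedin X {x \<in> topspace X. P x}" "closedin X {x \<in> topspace X. Q x}"
  shows "closedin X {x \<in> topspace X. P x \<and> Q x}"
proof -
  have "{x \<in> topspace X. P x \<and> Q x} = {x \<in> topspace X. P x} \<inter> {x \<in> topspace X. Q x}" by auto
  then show ?thesis using assms by (simp add: closedin_Int)
qed

lemma closedin_Collect_disj:
  assumes "closedin X {x \<in> topspace X. P x}" "closedin X {x \<in> topspace X. Q x}"
  shows "closedin X {x \<in> topspace X. P x \<or> Q x}"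
proof -
  have "{x \<in> topspace X. P x \<or> Q x} = {x \<in> topspace X. P x} \<union> {x \<in> topspace X. Q x}" by auto
  then show ?thesis using assms by (simp add: closedin_Un)
qed

lemma closedin_Collect_bex_less:
  fixes k :: nat
  assumes "\<And>n. closedin X {x \<in> topspace X. P n x}"
  shows "closedin X {x \<in> topspace X. \<exists>n<k. P n x}"
proof -
  have "{x \<in> topspace X. \<exists>n<k. P n x} = (\<Union>n<k. {x \<in> topspace X. P n x})" by auto
  then show ?thesis using assms by (auto intro!: closedin_Union)
qed

lemmas closedin_Collect = closedin_Collect_all closedin_Collect_imp closedin_Collect_conj
  closedin_Collect_disj closedin_Collect_bex_less closedin_Collect_le closedin_Collect_eq

lemma compactin_helly_functions: "compactin (pointwise_topology unit_segment) helly_functions"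
proof (rule closed_compactin)
  let ?X = "pointwise_topology unit_segment"
  show "compactin ?X (topspace unit_segment \<rightarrow>\<^sub>E {0..1})"
    by (simp add: pointwise_topology_def compactin_PiE)
  show "helly_functions \<subseteq> topspace unit_segment \<rightarrow>\<^sub>E {0..1}"
    by (auto simp: helly_functions_def)
  have eval: "continuous_map ?X euclideanreal (\<lambda>f. f z)" if "z \<in> topspace unit_segment" for z
    unfolding pointwise_topology_def using that by (rule continuous_map_product_projection)
  have eq: "helly_functions = (topspace unit_segment \<rightarrow>\<^sub>E {0..1}) \<inter>
      {f \<in> topspace ?X. \<forall>s t. s \<in> {0..1} \<longrightarrow> t \<in> {0..1} \<longrightarrow> s \<le> t \<longrightarrow> f (\<lambda>_. s) \<le> f (\<lambda>_. t)}"
    by (auto simp: helly_functions_def pointwise_topology_def PiE_def)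
   have "closedin ?X (topspace unit_segment \<rightarrow>\<^sub>E {0..1})"
    by (simp add: pointwise_topology_def closedin_product_topology)
  moreover have "closedin ?X
      {f \<in> topspace ?X. \<forall>s t. s \<in> {0..1} \<longrightarrow> t \<in> {0..1} \<longrightarrow> s \<le> t \<longrightarrow> f (\<lambda>_. s) \<le> f (\<lambda>_. t)}"
    by (intro closedin_Collect eval) simp_all
  ultimately show "closedin ?X helly_functions" unfolding eq by (rule closedin_Int)
qed

lemma compact_space_helly_space: "compact_space helly_space"
  unfolding helly_space_def by (rule compact_space_subtopology) (rule compactin_helly_functions)

lemma Hausdorff_space_helly_space: "Hausdorff_space helly_space"
  unfolding helly_space_def pointwise_topology_def
  by (intro Hausdorff_space_subtopology) (simp add: Hausdorff_space_product_topology)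

subsection \<open>Separability\<close>

lemma separable_space_helly_space: "separable_space helly_space"
proof -
  let ?X = "topspace unit_segment"
  define \<A> where "\<A> = {A. finite A \<and> A \<subseteq> (\<rat> :: real set) \<times> (\<rat> \<inter> {0..1::real})}"
  define D where "D = (\<lambda>A. helly_of (step_function A)) ` \<A>"
  have sub: "D \<subseteq> helly_functions"
  proof
    fix g assume "g \<in> D"
    then obtain A where A: "finite A" "A \<subseteq> \<rat> \<times> (\<rat> \<inter> {0..1})" "g = helly_of (step_function A)"
      by (auto simp: D_def \<A>_def)
    moreover have "snd ` A \<subseteq> {0..1}" using A(2) by auto
    ultimately show "g \<in> helly_functions"
      by (auto intro!: helly_of_in_helly_functions mono_onI step_function_mono step_function_bounds
          simp del: atLeastAtMost_iff)
  qed
  have "countable \<A>"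
    unfolding \<A>_def
    by (intro countable_Collect_finite_subset countable_SIGMA countable_rat countable_Int1) 
  then have "countable D" by (simp add: D_def)
  moreover have "f \<in> helly_space closure_of D" if f: "f \<in> helly_functions" for f
    unfolding in_closure_of
  proof (intro conjI allI impI)
    fix W assume W: "f \<in> W \<and> openin helly_space W"
    then obtain G where G: "openin (pointwise_topology unit_segment) G" "W = G \<inter> helly_functions"
      by (auto simp: helly_space_def openin_subtopology)
    then obtain U where fin: "finite {z \<in> ?X. U z \<noteq> UNIV}" and op: "\<And>z. z \<in> ?X \<Longrightarrow> open (U z)"
        and fU: "f \<in> PiE ?X U" and UG: "PiE ?X U \<subseteq> G"
      using W by (auto simp: pointwise_topology_def openin_product_topology_alt Ball_def)
    define T where "T = {t \<in> {0..1}. U (\<lambda>_. t) \<noteq> UNIV}"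
    have "inj (\<lambda>t::real. (\<lambda>_::nat. t))" by (auto simp: inj_def fun_eq_iff)
    moreover have "(\<lambda>t _. t) ` T \<subseteq> {z \<in> ?X. U z \<noteq> UNIV}" by (auto simp: T_def)
    ultimately have "finite T"
      using fin by (meson finite_imageD finite_subset inj_on_subset subset_UNIV)
    have "\<exists>d>0. ball (f (\<lambda>_. t)) d \<subseteq> U (\<lambda>_. t)" if "t \<in> T" for t
    proof -
      have "(\<lambda>_. t) \<in> ?X" using that by (simp add: T_def)
      then have "open (U (\<lambda>_. t))" "f (\<lambda>_. t) \<in> U (\<lambda>_. t)" using op fU by (auto dest: PiE_mem)
      then show ?thesis by (meson openE)
    qed
    then obtain d where d: "\<And>t. t \<in> T \<Longrightarrow> 0 < d t \<and> ball (f (\<lambda>_. t)) (d t) \<subseteq> U (\<lambda>_. t)"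
      by metis
    define e where "e = Min (insert 1 (d ` T))"
    have "0 < e" using \<open>finite T\<close> d by (auto simp: e_def)
    have T01: "T \<subseteq> {0..1}" by (auto simp: T_def)
    have "\<exists>A. finite A \<and> A \<subseteq> \<rat> \<times> (\<rat> \<inter> {0..1}) \<and>
        (\<forall>t\<in>T. \<bar>step_function A t - f (\<lambda>_. t)\<bar> < e)"
      using f T01 \<open>0 < e\<close> \<open>finite T\<close> helly_functions_bounds[OF f]
      by (intro step_function_approximation) 
         (auto intro!: mono_onI helly_functions_mono[OF f] simp: subset_iff simp del: atLeastAtMost_iff, auto)
    then obtain A where A: "A \<in> \<A>" and app: "\<And>t. t \<in> T \<Longrightarrow> \<bar>step_function A t - f (\<lambda>_. t)\<bar> < e"
      by (auto simp: \<A>_def)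
    let ?g = "helly_of (step_function A)"
    have gD: "?g \<in> D" using A by (simp add: D_def)
    have "?g z \<in> U z" if z: "z \<in> ?X" for z
    proof -
      obtain t where t: "t \<in> {0..1}" "z = (\<lambda>_. t)" using z by (auto simp: topspace_unit_segment)
      show ?thesis
      proof (cases "t \<in> T")
        case True
        have "e \<le> d t" unfolding e_def using \<open>finite T\<close> True by (intro Min_le) auto
        then have "step_function A t \<in> ball (f (\<lambda>_. t)) (d t)"
          using app[OF True] by (auto simp: dist_real_def)
        then show ?thesis using d[OF True] t by auto
      next
        case False
        then show ?thesis using t by (simp add: T_def)
      qed
    qed
    then have "?g \<in> PiE ?X U" by (auto simp: helly_of_def)
    then show "\<exists>y. y \<in> D \<and> y \<in> W" using UG G gD sub by blast
  qed (use f in simp)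
  ultimately show ?thesis
    unfolding separable_space_def using sub closure_of_subset_topspace[of helly_space D]
    by (metis subsetI subset_antisym topspace_helly_space)
qed

subsection \<open>Regularity of increasing functions\<close>

lemma compact_unit_segment: "compact_space unit_segment"
proof -
  have "compact ((\<lambda>t (_::nat). t) ` {0..1::real})"
    by (intro compact_continuous_image continuous_on_coordinatewise_then_product) auto
  then show ?thesis by (simp add: unit_segment_def compact_space_subtopology)
qed

lemma metrizable_unit_segment: "metrizable_space unit_segment"
  unfolding unit_segment_def by (intro metrizable_space_subtopology metrizable_space_euclidean)

lemma Polish_unit_segment: "Polish_space unit_segment"
proof -
  have "second_countable (euclidean :: (nat \<Rightarrow> real) topology)"
    unfolding second_countable_def
  proof -
    obtain \<B> :: "(nat \<Rightarrow> real) set set" where "countable \<B>" "topological_basis \<B>"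
      using ex_countable_basis by blast
    then show "\<exists>\<B>::(nat \<Rightarrow> real) set set. countable \<B> \<and> (\<forall>V\<in>\<B>. openin euclidean V) \<and>
        (\<forall>U x. openin euclidean U \<and> x \<in> U \<longrightarrow> (\<exists>V\<in>\<B>. x \<in> V \<and> V \<subseteq> U))"
      by (metis open_openin topological_basisE topological_basis_open)
  qed
  then have "separable_space unit_segment"
    unfolding unit_segment_def
    by (intro second_countable_imp_separable_space second_countable_subtopology)
  then show ?thesis
    unfolding Polish_space_def
    using locally_compact_imp_completely_metrizable_space metrizable_unit_segment
      compact_unit_segment compact_imp_locally_compact_space
    by blast
qed

lemma continuous_map_unit_segment_parameter: "continuous_map unit_segment euclideanreal (\<lambda>z. z 0)"
proof -
  have "continuous_map (euclidean :: (nat \<Rightarrow> real) topology) euclideanreal (\<lambda>z. z 0)"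
    by (simp add: continuous_on_product_coordinates)
  then show ?thesis unfolding unit_segment_def by (rule continuous_map_from_subtopology)
qed

text \<open>Extending by constants to the whole line makes the results on monotone functions of a real
  variable applicable.\<close>

definition real_extension :: "((nat \<Rightarrow> real) \<Rightarrow> real) \<Rightarrow> real \<Rightarrow> real" where
  "real_extension f t = f (\<lambda>_. max 0 (min 1 t))"

lemma mono_real_extension: "f \<in> helly_functions \<Longrightarrow> mono (real_extension f)"
  unfolding real_extension_def
  by (rule monoI, rule helly_functions_mono) (simp_all add: max_def min_def)

lemma real_extension_eq: "z \<in> topspace unit_segment \<Longrightarrow> real_extension f (z 0) = f z"
  by (auto simp: real_extension_def topspace_unit_segment)

lemma countable_discontinuities_helly:
  assumes f: "f \<in> helly_functions"
  shows "countable (discontinuities unit_segment f)"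
proof -
  let ?D = "{t. \<not> isCont (real_extension f) t}"
  have "z \<in> (\<lambda>t _. t) ` ?D" if "z \<in> discontinuities unit_segment f" for z
  proof (rule ccontr)
    assume z: "z \<notin> (\<lambda>t _. t) ` ?D"
    have zX: "z \<in> topspace unit_segment" using that by (simp add: discontinuities_def)
    then have "z = (\<lambda>_. z 0)" by (auto simp: topspace_unit_segment)
    then have cont: "isCont (real_extension f) (z 0)" using z by blast
    have "topcontinuous_at unit_segment euclideanreal f z"
      unfolding topcontinuous_at_def
    proof (intro conjI allI impI)
      fix V assume "openin euclideanreal V \<and> f z \<in> V"
      then have "open V" "real_extension f (z 0) \<in> V" using real_extension_eq[OF zX] by auto
      then obtain S where S: "open S" "z 0 \<in> S" "\<forall>t\<in>S. real_extension f t \<in> V"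
        using cont unfolding continuous_at_open by blast
      have "openin unit_segment {y \<in> topspace unit_segment. y 0 \<in> S}"
        using S(1) by (intro openin_continuous_map_preimage[OF continuous_map_unit_segment_parameter]) simp
      then show "\<exists>U. openin unit_segment U \<and> z \<in> U \<and> (\<forall>y\<in>U. f y \<in> V)"
        using zX S by (intro exI[of _ "{y \<in> topspace unit_segment. y 0 \<in> S}"])
          (auto simp flip: real_extension_eq)
    qed (use zX in auto)
    then show False using that by (simp add: discontinuities_def)
  qed
  then have "discontinuities unit_segment f \<subseteq> (\<lambda>t _. t) ` ?D" by blast
  moreover have "countable ?D" by (intro mono_ctble_discont mono_real_extension f)
  ultimately show ?thesis by (meson countable_image countable_subset)
qed

text \<open>Interpolate \<open>f\<close> continuously at more and more points of a countable set containing the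
  discontinuities and the rationals. On that set the values are eventually exact; at a point of
  continuity they are squeezed between the values at two nearby rationals.\<close>

lemma first_Baire_class_helly:
  assumes f: "f \<in> helly_functions"
  shows "first_Baire_class unit_segment f"
proof -
  let ?u = "real_extension f"
  have mono: "mono ?u" by (rule mono_real_extension[OF f])
  define Q where "Q = {t. \<not> isCont ?u t} \<union> \<rat>"
  have "countable Q" unfolding Q_def by (simp add: mono_ctble_discont[OF mono] countable_rat)
  moreover have "Q \<noteq> {}" unfolding Q_def using Rats_0 by blast
  ultimately have Q: "range (from_nat_into Q) = Q" by (rule range_from_nat_into[rotated])
  define P where "P n = from_nat_into Q ` {..n}" for n :: nat
  have "\<exists>g. continuous_on UNIV g \<and> mono g \<and> (\<forall>p\<in>P n. g p = ?u p)" for n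
    using mono by (intro monotone_continuous_interpolation) (auto simp: P_def mono_on_def mono_def)
  then obtain g where g: "\<And>n. continuous_on UNIV (g n)" "\<And>n. mono (g n)"
      "\<And>n p. p \<in> P n \<Longrightarrow> g n p = ?u p"
    by metis
  have ev: "\<forall>\<^sub>F n in sequentially. g n p = ?u p" if pQ: "p \<in> Q" for p
  proof -
    have "p \<in> range (from_nat_into Q)" using pQ Q by simp
    then obtain m where m: "p = from_nat_into Q m" by (rule rangeE)
    have "g n p = ?u p" if "m \<le> n" for n
      using that m by (intro g(3)) (simp add: P_def)
    then show ?thesis unfolding eventually_sequentially by blast
  qed
  have lim: "(\<lambda>n. g n t) \<longlonglongrightarrow> ?u t" for t
  proof (cases "t \<in> Q")
    case True
    then show ?thesis using ev by (intro tendsto_eventually) auto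
  next
    case False
    then have cont: "isCont ?u t" by (simp add: Q_def)
    show ?thesis
    proof (rule tendstoI)
      fix e :: real assume "0 < e"
      then obtain d where d: "0 < d" "\<And>s. dist s t < d \<Longrightarrow> dist (?u s) (?u t) < e"
        using cont unfolding continuous_at_eps_delta by (metis dist_real_def)
      obtain p where p: "p \<in> \<rat>" "t - d < p" "p < t" using Rats_dense_in_real[of "t - d" t] d by auto
      obtain q where q: "q \<in> \<rat>" "t < q" "q < t + d" using Rats_dense_in_real[of t "t + d"] d by auto
      have "dist (?u p) (?u t) < e" "dist (?u q) (?u t) < e"
        using p q d(2)[of p] d(2)[of q] by (auto simp: dist_real_def)
      moreover have "\<forall>\<^sub>F n in sequentially. g n p = ?u p \<and> g n q = ?u q"
        using p q by (intro eventually_conj ev) (auto simp: Q_def)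
      moreover have "g n p \<le> g n t" "g n t \<le> g n q" for n
        using g(2)[of n] p q by (auto simp: mono_def)
      ultimately show "\<forall>\<^sub>F n in sequentially. dist (g n t) (?u t) < e"
        by (elim eventually_mono) (auto simp: dist_real_def abs_less_iff, (smt (verit))+)
    qed
  qed
  show ?thesis
    unfolding first_Baire_class_def
  proof (intro exI[of _ "\<lambda>n z. g n (z 0)"] conjI allI ballI)
    fix n
    show "continuous_map unit_segment euclideanreal (\<lambda>z. g n (z 0))"
      using continuous_map_compose[OF continuous_map_unit_segment_parameter, of euclideanreal "g n"] g(1)
      by (simp add: o_def)
  next
    fix z assume "z \<in> topspace unit_segment"
    then show "(\<lambda>n. g n (z 0)) \<longlonglongrightarrow> f z" using lim by (simp flip: real_extension_eq)
  qed
qed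

lemma Rosenthal_compact_helly_space: "Rosenthal_compact helly_space"
  unfolding Rosenthal_compact_def
  using compact_space_helly_space Polish_unit_segment compactin_helly_functions
    first_Baire_class_helly homeomorphic_space_refl helly_space_def
  by metis

lemma class_CD_helly_space: "class_CD helly_space"
  unfolding class_CD_def
  using compact_space_helly_space compact_unit_segment metrizable_unit_segment
    compactin_helly_functions countable_discontinuities_helly homeomorphic_space_refl helly_space_def
  by metis

section \<open>Images of closed subsets of the Helly space\<close>

text \<open>The class of spaces for which the conclusion is shown. It is closed under continuous images, closed
  subspaces and countable products, and a single compact space, the Helly space, serves for all its
  members.\<close>

definition helly_image :: "'h topology \<Rightarrow> bool" where
  "helly_image H \<longleftrightarrow> (\<exists>C g. closedin helly_space C \<and>
     continuous_map (subtopology helly_space C) H g \<and> g ` C = topspace H)"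

lemma helly_imageI:
  "closedin helly_space C \<Longrightarrow> continuous_map (subtopology helly_space C) H g \<Longrightarrow>
    g ` C = topspace H \<Longrightarrow> helly_image H"
  by (auto simp: helly_image_def)

lemma helly_image_of_closed:
  assumes H: "helly_image H" and S: "closedin H S"
    and f: "continuous_map (subtopology H S) H' f" and im: "f ` S = topspace H'"
  shows "helly_image H'"
proof -
  obtain C g where C: "closedin helly_space C"
    and g: "continuous_map (subtopology helly_space C) H g" and gC: "g ` C = topspace H"
    using H by (auto simp: helly_image_def)
  have CH: "C \<subseteq> helly_functions" using closedin_subset[OF C] by simp
  then have tC: "topspace (subtopology helly_space C) = C" by auto
  let ?C = "{x \<in> C. g x \<in> S}"
  show ?thesis
  proof (rule helly_imageI)
    have "closedin (subtopology helly_space C) ?C"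
      using closedin_continuous_map_preimage[OF g S] unfolding tC .
    then show "closedin helly_space ?C" using C by (rule closedin_trans_full)
    have "continuous_map (subtopology helly_space ?C) (subtopology H S) g"
      by (intro continuous_map_into_subtopology continuous_map_from_subtopology_mono[OF g]) auto
    then show "continuous_map (subtopology helly_space ?C) H' (f \<circ> g)"
      using f by (rule continuous_map_compose)
    have "g ` ?C = g ` C \<inter> S" by auto
    then have "g ` ?C = S" using gC closedin_subset[OF S] by auto
    then show "(f \<circ> g) ` ?C = topspace H'" using im by (simp only: image_comp[symmetric])
  qed
qed

lemma helly_image_of_image:
  assumes "helly_image H" "continuous_map H H' f" "f ` topspace H = topspace H'"
  shows "helly_image H'"
  by (rule helly_image_of_closed[OF assms(1), of "topspace H" _ f]) (use assms in auto)

lemma continuous_map_into_helly_space: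
  assumes "\<And>t. t \<in> {0..1} \<Longrightarrow> continuous_map X euclideanreal (\<lambda>x. \<phi> x (\<lambda>_. t))"
    and "\<And>x. x \<in> topspace X \<Longrightarrow> \<phi> x \<in> helly_functions"
  shows "continuous_map X helly_space \<phi>"
  unfolding helly_space_def pointwise_topology_def
proof (intro continuous_map_into_subtopology)
  have "\<phi> x \<in> extensional (topspace unit_segment)" if "x \<in> topspace X" for x
    using assms(2)[OF that] by (simp add: helly_functions_def PiE_iff)
  then show "continuous_map X (product_topology (\<lambda>_. euclideanreal) (topspace unit_segment)) \<phi>"
    using assms(1) by (auto simp: continuous_map_componentwise topspace_unit_segment)
qed (use assms(2) in auto)

lemma helly_functions_ext:
  assumes "f \<in> helly_functions" "g \<in> helly_functions" "\<And>t. t \<in> {0..1} \<Longrightarrow> f (\<lambda>_. t) = g (\<lambda>_. t)"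
  shows "f = g"
proof (rule PiE_ext)
  show "f \<in> topspace unit_segment \<rightarrow>\<^sub>E {0..1}" "g \<in> topspace unit_segment \<rightarrow>\<^sub>E {0..1}"
    using assms(1,2) by (auto simp: helly_functions_def)
  show "f z = g z" if "z \<in> topspace unit_segment" for z
    using that assms(3) by (auto simp: topspace_unit_segment)
qed

lemma continuous_map_coordinate:
  "continuous_map Y Z g \<Longrightarrow> k \<in> I \<Longrightarrow>
    continuous_map (product_topology (\<lambda>_. Y) I) Z (\<lambda>\<phi>. g (\<phi> k))"
  using continuous_map_compose[of "product_topology (\<lambda>_. Y) I" Y "\<lambda>\<phi>. \<phi> k" Z g]
    continuous_map_product_projection[of k I "\<lambda>_. Y"]
  by (simp add: o_def)

text \<open>The Helly space contains its own countable power: place countably many disjoint intervals in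
  \<open>[0,1]\<close> and consider the increasing functions that map each of these intervals into itself. Rescaling
  gives an independent increasing function on each interval. Any such sequence of functions occurs,
  since the pieces fit together to an increasing function on the union of the intervals, which extends
  to \<open>[0,1]\<close>.\<close>

lemma helly_image_helly_power: "helly_image (product_topology (\<lambda>_::nat. helly_space) UNIV)"
proof -
  \<comment> \<open>The intervals are \<open>[l n, 3/2 l n]\<close>, decreasing to \<open>0\<close> and separated by gaps, and \<open>e n\<close>
  parametrizes the \<open>n\<close>-th of them.\<close>
  define l :: "nat \<Rightarrow> real" where "l n = (1 / 2) ^ (n + 1)" for n
  have l0: "0 < l n" for n by (simp add: l_def)
  have l1: "2 * l n \<le> 1" for n by (simp add: l_def power_le_one)
  have l_less: "2 * l n \<le> l m" if "m < n" for m n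
    using power_decreasing[of "m + 1" n "1 / 2 :: real"] that by (simp add: l_def)
  define e where "e n t = l n * (1 + t / 2)" for n t
  have e_ge: "l n \<le> e n t" if "0 \<le> t" for n t using l0[of n] that by (simp add: e_def)
  have e_le: "e n t < 2 * l n" if "t \<le> 1" for n t using l0[of n] that by (simp add: e_def)
  have e01: "e n t \<in> {0..1}" if "t \<in> {0..1}" for n t
    using e_ge[of t n] e_le[of t n] l0[of n] l1[of n] that by auto
  have e_less: "e n s < e m t" if "m < n" "s \<in> {0..1}" "t \<in> {0..1}" for m n s t
    using e_le[of s n] e_ge[of t m] l_less[OF that(1)] that by auto
  have e_mono: "e n s \<le> e n t \<longleftrightarrow> s \<le> t" for n s t
    using l0[of n] by (simp add: e_def)
  define C where "C = {f \<in> topspace helly_space. \<forall>n t. t \<in> {0..1} \<longrightarrow>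
      l n \<le> f (\<lambda>_. e n t) \<and> f (\<lambda>_. e n t) \<le> 3 / 2 * l n}"
  define part where "part f n = helly_of (\<lambda>t. 2 * (f (\<lambda>_. e n t) / l n - 1))"
    for f :: "(nat \<Rightarrow> real) \<Rightarrow> real" and n
  have C_helly: "C \<subseteq> helly_functions" by (auto simp: C_def)
  have CD: "l n \<le> f (\<lambda>_. e n t)" "f (\<lambda>_. e n t) \<le> 3 / 2 * l n"
    if "f \<in> C" "t \<in> {0..1}" for f n t
    using that by (auto simp: C_def)
  have part_in: "part f n \<in> helly_functions" if f: "f \<in> C" for f n
    unfolding part_def
  proof (rule helly_of_in_helly_functions)
    fix t :: real assume t: "t \<in> {0..1}"
    show "2 * (f (\<lambda>_. e n t) / l n - 1) \<in> {0..1}"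
      using CD[OF f t, of n] l0[of n] by (simp add: field_simps)
  next
    show "mono_on {0..1} (\<lambda>t. 2 * (f (\<lambda>_. e n t) / l n - 1))"
    proof (rule mono_onI)
      fix s t :: real assume st: "s \<in> {0..1}" "t \<in> {0..1}" "s \<le> t"
      have "f (\<lambda>_. e n s) \<le> f (\<lambda>_. e n t)"
        using C_helly f st e01[of s n] e01[of t n] e_mono[of n s t]
        by (intro helly_functions_mono[of f]) auto
      then show "2 * (f (\<lambda>_. e n s) / l n - 1) \<le> 2 * (f (\<lambda>_. e n t) / l n - 1)"
        using l0[of n] by (simp add: divide_right_mono)
    qed
  qed
  show ?thesis
  proof (rule helly_imageI[of C _ part])
    show "closedin helly_space C"
      unfolding C_def by (intro closedin_Collect continuous_map_helly_eval e01) simp_all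
    show "continuous_map (subtopology helly_space C) (product_topology (\<lambda>_::nat. helly_space) UNIV) part"
      unfolding continuous_map_componentwise_UNIV
    proof (intro allI continuous_map_into_helly_space)
      fix n and t :: real assume t: "t \<in> {0..1}"
      have "continuous_map (subtopology helly_space C) euclideanreal (\<lambda>f. 2 * (f (\<lambda>_. e n t) / l n - 1))"
        using l0[of n]
        by (intro continuous_intros continuous_map_from_subtopology continuous_map_helly_eval e01 t) auto
      then show "continuous_map (subtopology helly_space C) euclideanreal (\<lambda>f. part f n (\<lambda>_. t))"
        using t by (simp add: part_def)
    qed (use part_in in auto)
    show "part ` C = topspace (product_topology (\<lambda>_::nat. helly_space) UNIV)"
    proof
      show "part ` C \<subseteq> topspace (product_topology (\<lambda>_::nat. helly_space) UNIV)"
        using part_in by auto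
    next
      show "topspace (product_topology (\<lambda>_::nat. helly_space) UNIV) \<subseteq> part ` C"
      proof
        fix \<phi> assume "\<phi> \<in> topspace (product_topology (\<lambda>_::nat. helly_space) UNIV)"
        then have \<phi>: "\<phi> n \<in> helly_functions" for n by auto
        define v where "v i = e (fst i) (\<phi> (fst i) (\<lambda>_. snd i))" for i
        have \<phi>01: "\<phi> n (\<lambda>_. t) \<in> {0..1}" if "t \<in> {0..1}" for n t
          using helly_functions_bounds[OF \<phi> that] .
        have "\<exists>f\<in>helly_functions. \<forall>i \<in> UNIV \<times> {0..1}. f (\<lambda>_. e (fst i) (snd i)) = v i"
        proof (rule helly_interpolation)
          fix i j :: "nat \<times> real"
          assume ij: "i \<in> UNIV \<times> {0..1}" "j \<in> UNIV \<times> {0..1}"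
            and le: "e (fst i) (snd i) \<le> e (fst j) (snd j)"
          consider "fst i < fst j" | "fst i = fst j" | "fst j < fst i" by linarith
          then show "v i \<le> v j"
          proof cases
            case 1
            then show ?thesis using e_less[OF 1, of "snd j" "snd i"] ij le by auto
          next
            case 2
            then have "snd i \<le> snd j" using le by (simp add: e_mono)
            then show ?thesis
              using 2 ij helly_functions_mono[OF \<phi>, of "snd i" "snd j" "fst j"] by (auto simp: v_def e_mono)
          next
            case 3
            then show ?thesis
              unfolding v_def using ij by (intro less_imp_le e_less \<phi>01) auto
          qed
        qed (use e01 \<phi>01 in \<open>auto simp: v_def simp del: atLeastAtMost_iff\<close>)
        then obtain f where f: "f \<in> helly_functions"
          and fe: "\<And>n t. t \<in> {0..1} \<Longrightarrow> f (\<lambda>_. e n t) = e n (\<phi> n (\<lambda>_. t))"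
          by (auto simp: v_def)
        have "f \<in> C"
          unfolding C_def
        proof (intro CollectI conjI allI impI)
          fix n and t :: real assume t: "t \<in> {0..1}"
          have "0 \<le> \<phi> n (\<lambda>_. t)" "\<phi> n (\<lambda>_. t) \<le> 1" using \<phi>01[OF t, of n] by auto
          then show "l n \<le> f (\<lambda>_. e n t)" "f (\<lambda>_. e n t) \<le> 3 / 2 * l n"
            unfolding fe[OF t] using l0[of n] by (simp_all add: e_def)
        qed (use f in simp)
        moreover have "part f = \<phi>"
        proof
          fix n
          show "part f n = \<phi> n"
          proof (rule helly_functions_ext[OF part_in[OF \<open>f \<in> C\<close>] \<phi>])
            fix t :: real assume t: "t \<in> {0..1}"
            then show "part f n (\<lambda>_. t) = \<phi> n (\<lambda>_. t)"
              using l0[of n] fe[OF t, of n] by (simp add: part_def e_def)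
          qed
        qed
        ultimately show "\<phi> \<in> part ` C" by blast
      qed
    qed
  qed
qed

lemma helly_image_prod:
  assumes "helly_image H1" "helly_image H2"
  shows "helly_image (prod_topology H1 H2)"
proof -
  obtain C1 g1 where 1: "closedin helly_space C1"
      "continuous_map (subtopology helly_space C1) H1 g1" "g1 ` C1 = topspace H1"
    using assms(1) by (auto simp: helly_image_def)
  obtain C2 g2 where 2: "closedin helly_space C2"
      "continuous_map (subtopology helly_space C2) H2 g2" "g2 ` C2 = topspace H2"
    using assms(2) by (auto simp: helly_image_def)
  have "helly_image (prod_topology helly_space helly_space)"
  proof (rule helly_image_of_image[OF helly_image_helly_power])
    let ?P = "product_topology (\<lambda>_::nat. helly_space) UNIV"
    show "continuous_map ?P (prod_topology helly_space helly_space) (\<lambda>\<phi>. (\<phi> 0, \<phi> 1))"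
      by (intro continuous_map_pairedI continuous_map_product_projection) auto
    have "(x, y) \<in> (\<lambda>\<phi>. (\<phi> 0, \<phi> 1)) ` topspace ?P" if "x \<in> helly_functions" "y \<in> helly_functions" for x y
      using that by (intro image_eqI[of _ _ "\<lambda>n::nat. if n = 0 then x else y"]) auto
    then show "(\<lambda>\<phi>. (\<phi> 0, \<phi> 1)) ` topspace ?P = topspace (prod_topology helly_space helly_space)"
      by auto
  qed
  then show ?thesis
  proof (rule helly_image_of_closed)
    show "closedin (prod_topology helly_space helly_space) (C1 \<times> C2)"
      using 1 2 by (simp add: closedin_prod_Times_iff)
    show "continuous_map (subtopology (prod_topology helly_space helly_space) (C1 \<times> C2))
        (prod_topology H1 H2) (\<lambda>(x, y). (g1 x, g2 y))"
      using 1 2 by (simp add: subtopology_Times continuous_map_prod_top)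
    show "(\<lambda>(x, y). (g1 x, g2 y)) ` (C1 \<times> C2) = topspace (prod_topology H1 H2)"
      using 1(3) 2(3) by (auto simp flip: 1(3) 2(3) intro!: image_eqI)
  qed
qed

lemma helly_image_power:
  assumes "helly_image H"
  shows "helly_image (product_topology (\<lambda>_::nat. H) UNIV)"
proof -
  obtain C g where C: "closedin helly_space C"
    and g: "continuous_map (subtopology helly_space C) H g" and gC: "g ` C = topspace H"
    using assms by (auto simp: helly_image_def)
  let ?P = "product_topology (\<lambda>_::nat. helly_space) UNIV"
  have sub: "subtopology ?P (UNIV \<rightarrow>\<^sub>E C) = product_topology (\<lambda>_. subtopology helly_space C) UNIV"
    by (rule subtopology_product_topology)
  show ?thesis
  proof (rule helly_image_of_closed[OF helly_image_helly_power])
    show "closedin ?P (UNIV \<rightarrow>\<^sub>E C)" using C by (simp add: closedin_product_topology)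
    have "continuous_map (product_topology (\<lambda>_. subtopology helly_space C) UNIV) H (\<lambda>\<phi>. g (\<phi> n))" for n :: nat
      using g by (rule continuous_map_coordinate) simp
    then show "continuous_map (subtopology ?P (UNIV \<rightarrow>\<^sub>E C)) (product_topology (\<lambda>_::nat. H) UNIV)
        (\<lambda>\<phi> n. g (\<phi> n))"
      by (simp add: sub continuous_map_componentwise_UNIV)
    show "(\<lambda>\<phi> n. g (\<phi> n)) ` (UNIV \<rightarrow>\<^sub>E C) = topspace (product_topology (\<lambda>_::nat. H) UNIV)"
    proof
      show "(\<lambda>\<phi> n. g (\<phi> n)) ` (UNIV \<rightarrow>\<^sub>E C) \<subseteq> topspace (product_topology (\<lambda>_::nat. H) UNIV)"
        using gC by (auto simp: PiE_iff)
    next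
      have "\<phi> \<in> (\<lambda>\<phi> n. g (\<phi> n)) ` (UNIV \<rightarrow>\<^sub>E C)" if "\<And>n. \<phi> n \<in> topspace H" for \<phi> :: "nat \<Rightarrow> _"
      proof -
        have "\<exists>c\<in>C. g c = \<phi> n" for n using that[of n] gC by (metis imageE)
        then obtain c where "\<And>n. c n \<in> C" "\<And>n. g (c n) = \<phi> n" by metis
        then show ?thesis by (intro image_eqI[of _ _ c]) auto
      qed
      then show "topspace (product_topology (\<lambda>_::nat. H) UNIV) \<subseteq> (\<lambda>\<phi> n. g (\<phi> n)) ` (UNIV \<rightarrow>\<^sub>E C)"
        by (auto simp: PiE_iff)
    qed
  qed
qed

section \<open>Spaces of increasing functions\<close>

text \<open>For the lexicographic order on the cube \<open>{0,1}\<^sup>\<alpha>\<close> this is \<open>\<H>\<^sub>\<alpha>\<close>.\<close>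

definition increasing_functions :: "'b set \<Rightarrow> ('b \<Rightarrow> 'b \<Rightarrow> bool) \<Rightarrow> ('b \<Rightarrow> real) set" where
  "increasing_functions B lt = {f \<in> B \<rightarrow>\<^sub>E {0..1}. \<forall>x\<in>B. \<forall>y\<in>B. lt x y \<longrightarrow> f x \<le> f y}"

definition increasing_space :: "'b set \<Rightarrow> ('b \<Rightarrow> 'b \<Rightarrow> bool) \<Rightarrow> ('b \<Rightarrow> real) topology" where
  "increasing_space B lt =
     subtopology (product_topology (\<lambda>_. euclideanreal) B) (increasing_functions B lt)"

lemma topspace_increasing_space [simp]: "topspace (increasing_space B lt) = increasing_functions B lt"
  by (auto simp: increasing_space_def increasing_functions_def PiE_def)

lemma increasing_functions_bounds:
  "f \<in> increasing_functions B lt \<Longrightarrow> x \<in> B \<Longrightarrow> 0 \<le> f x \<and> f x \<le> 1"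
  by (auto simp: increasing_functions_def dest: PiE_mem)

lemma continuous_map_increasing_eval:
  "x \<in> B \<Longrightarrow> continuous_map (increasing_space B lt) euclideanreal (\<lambda>f. f x)"
  unfolding increasing_space_def
  by (intro continuous_map_from_subtopology continuous_map_product_projection)

lemma continuous_map_into_increasing_space:
  assumes "\<And>b. b \<in> B \<Longrightarrow> continuous_map X euclideanreal (\<lambda>x. \<phi> x b)"
    and "\<And>x. x \<in> topspace X \<Longrightarrow> \<phi> x \<in> increasing_functions B lt"
  shows "continuous_map X (increasing_space B lt) \<phi>"
  unfolding increasing_space_def
proof (intro continuous_map_into_subtopology)
  have "\<phi> x \<in> extensional B" if "x \<in> topspace X" for x
    using assms(2)[OF that] by (simp add: increasing_functions_def PiE_iff)
  then show "continuous_map X (product_topology (\<lambda>_. euclideanreal) B) \<phi>"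
    using assms(1) by (auto simp: continuous_map_componentwise)
qed (use assms(2) in auto)

lemma helly_image_increasing_space_iso:
  assumes H: "helly_image (increasing_space B lt)" and bij: "bij_betw h B' B"
    and iso: "\<And>x y. x \<in> B' \<Longrightarrow> y \<in> B' \<Longrightarrow> lt' x y \<longleftrightarrow> lt (h x) (h y)"
  shows "helly_image (increasing_space B' lt')"
proof (rule helly_image_of_image[OF H])
  have hB: "h x \<in> B" if "x \<in> B'" for x using bij that by (rule bij_betw_apply)
  let ?f = "\<lambda>f. \<lambda>x\<in>B'. f (h x)"
  have in': "?f f \<in> increasing_functions B' lt'" if "f \<in> increasing_functions B lt" for f
    using that hB iso by (auto simp: increasing_functions_def PiE_iff)
  show "continuous_map (increasing_space B lt) (increasing_space B' lt') ?f"
    using in' hB by (intro continuous_map_into_increasing_space) (auto intro: continuous_map_increasing_eval)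
  show "?f ` topspace (increasing_space B lt) = topspace (increasing_space B' lt')"
  proof
    show "?f ` topspace (increasing_space B lt) \<subseteq> topspace (increasing_space B' lt')"
      using in' by auto
  next
    have "f \<in> ?f ` increasing_functions B lt" if f: "f \<in> increasing_functions B' lt'" for f
    proof (rule image_eqI)
      let ?k = "inv_into B' h"
      have k: "?k y \<in> B'" "h (?k y) = y" if "y \<in> B" for y
        using bij that by (auto simp: bij_betw_def inv_into_into f_inv_into_f)
      have kh: "?k (h x) = x" if "x \<in> B'" for x
        using bij that by (simp add: bij_betw_def)
      show "(\<lambda>y\<in>B. f (?k y)) \<in> increasing_functions B lt"
        using f k iso by (auto simp: increasing_functions_def PiE_iff)
      show "f = ?f (\<lambda>y\<in>B. f (?k y))"
        using f hB kh by (auto simp: increasing_functions_def PiE_iff extensional_def fun_eq_iff)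
    qed
    then show "topspace (increasing_space B' lt') \<subseteq> ?f ` topspace (increasing_space B lt)" by auto
  qed
qed

text \<open>A countable family of numbers in \<open>[0,1]\<close> is a sequence of elements of the Helly space, evaluated at
  \<open>0\<close>, and being increasing is a closed condition on the family.\<close>

lemma helly_image_increasing_space_countable:
  assumes "countable B"
  shows "helly_image (increasing_space B lt)"
proof (rule helly_image_of_closed[OF helly_image_helly_power])
  let ?P = "product_topology (\<lambda>_::nat. helly_space) UNIV"
  let ?v = "\<lambda>\<phi> x. \<phi> (to_nat_on B x) (\<lambda>_. 0 :: real)"
  let ?S = "{\<phi> \<in> topspace ?P. \<forall>x y. x \<in> B \<longrightarrow> y \<in> B \<longrightarrow> lt x y \<longrightarrow> ?v \<phi> x \<le> ?v \<phi> y}"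
  have cont: "continuous_map ?P euclideanreal (\<lambda>\<phi>. ?v \<phi> x)" for x
    by (intro continuous_map_coordinate[OF continuous_map_helly_eval]) auto
  show "closedin ?P ?S"
    by (intro closedin_Collect cont)
  let ?f = "\<lambda>\<phi>. \<lambda>x\<in>B. ?v \<phi> x"
  have v01: "0 \<le> \<phi> n (\<lambda>_. 0)" "\<phi> n (\<lambda>_. 0) \<le> 1" if "\<phi> \<in> topspace ?P" for \<phi> n
    using helly_functions_bounds[of "\<phi> n" 0] that by auto
  have in': "?f \<phi> \<in> increasing_functions B lt" if "\<phi> \<in> ?S" for \<phi>
    using that v01[of \<phi>] by (auto simp: increasing_functions_def simp del: topspace_product_topology)
  show "continuous_map (subtopology ?P ?S) (increasing_space B lt) ?f"
    using in' by (intro continuous_map_into_increasing_space)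
      (auto intro!: continuous_map_from_subtopology cont simp del: topspace_product_topology)
  show "?f ` ?S = topspace (increasing_space B lt)"
  proof
    show "?f ` ?S \<subseteq> topspace (increasing_space B lt)" using in' by auto
  next
    have "f \<in> ?f ` ?S" if f: "f \<in> increasing_functions B lt" for f
    proof (rule image_eqI)
      define c where "c n = (if n \<in> to_nat_on B ` B then f (from_nat_into B n) else 0)" for n
      have c01: "c n \<in> {0..1}" for n
        using increasing_functions_bounds[OF f] assms by (auto simp: c_def)
      have cx: "c (to_nat_on B x) = f x" if "x \<in> B" for x
        using that assms by (auto simp: c_def)
      let ?\<phi> = "\<lambda>n. helly_of (\<lambda>_. c n)"
      have P: "?\<phi> \<in> topspace ?P"
        using c01 by (auto intro!: helly_of_in_helly_functions mono_onI simp del: atLeastAtMost_iff)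
      have v: "?v ?\<phi> x = f x" if "x \<in> B" for x using cx[OF that] by simp
      show "?\<phi> \<in> ?S"
        using P v f by (auto simp: increasing_functions_def simp del: topspace_product_topology)
      show "f = ?f ?\<phi>"
        using f v by (auto simp: increasing_functions_def PiE_iff extensional_def fun_eq_iff)
    qed
    then show "topspace (increasing_space B lt) \<subseteq> ?f ` ?S" by auto
  qed
qed

section \<open>Lexicographic products\<close>

text \<open>Here \<open>T\<close> is a set of reals and \<open>f\<close> an increasing function on the lexicographic product \<open>T \<times> B\<close>. Let
  \<open>a t\<close> and \<open>b t\<close> be the infimum and the supremum of \<open>f\<close> on the fibre over \<open>t\<close>. Both are increasing,
  the intervals \<open>[a t, b t]\<close> do not overlap, and where the jump \<open>b t - a t\<close> is positive, \<open>f\<close> is a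
  rescaled increasing function on \<open>B\<close>. The jumps sum up to at most \<open>1\<close>, so only countably many fibres
  carry information, and they can be listed so that the \<open>n\<close>-th jump is at most \<open>1 / (n + 1)\<close>.

  A code of \<open>f\<close> consists of \<open>a\<close>, \<open>b\<close>, for each \<open>n\<close> the indicator \<open>mark\<close> of the \<open>n\<close>-th listed point of
  \<open>T\<close> (or the function \<open>0\<close>), and the \<open>n\<close>-th increasing function on \<open>B\<close>. Recording indicators instead
  of the points themselves makes the disjointness of different marks a closed condition; an indicator is the
  difference of two increasing functions, so it is available in the Helly space. The bound on the
  unlisted jumps makes decoding a uniform limit of continuous maps.\<close>

definition lex_pair :: "('b \<Rightarrow> 'b \<Rightarrow> bool) \<Rightarrow> real \<times> 'b \<Rightarrow> real \<times> 'b \<Rightarrow> bool" where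
  "lex_pair lt p q \<longleftrightarrow> fst p < fst q \<or> fst p = fst q \<and> lt (snd p) (snd q)"

text \<open>Going through \<open>F\<close> from left to right, the jumps so far sum up to at most the lower end of the next
  interval.\<close>

lemma sum_disjoint_jumps:
  fixes a b :: "real \<Rightarrow> real"
  assumes "finite F" "F \<subseteq> T" and a: "\<And>t. t \<in> T \<Longrightarrow> 0 \<le> a t"
    and gap: "\<And>s t. s \<in> T \<Longrightarrow> t \<in> T \<Longrightarrow> s < t \<Longrightarrow> b s \<le> a t"
    and v: "0 \<le> v" "\<And>t. t \<in> F \<Longrightarrow> b t \<le> v"
  shows "(\<Sum>t\<in>F. b t - a t) \<le> v"
  using assms(1,2) v
proof (induction arbitrary: v rule: finite_linorder_max_induct)
  case (insert m F)
  have "(\<Sum>t\<in>F. b t - a t) \<le> a m"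
    using insert.prems insert.hyps by (intro insert.IH a gap) auto
  moreover have "m \<notin> F" using insert.hyps by auto
  moreover have "b m \<le> v" using insert.prems by simp
  ultimately show ?case using insert.hyps by simp
qed simp

text \<open>Ranking the points by decreasing jump, ties broken by their position, is the listing: the point
  of rank \<open>r\<close> is preceded by \<open>r\<close> points with jumps at least as large, and all these jumps together
  have sum at most \<open>1\<close>.\<close>

lemma bounded_rank_enumeration:
  fixes J :: "real \<Rightarrow> real"
  assumes sum: "\<And>F. finite F \<Longrightarrow> F \<subseteq> T \<Longrightarrow> (\<Sum>t\<in>F. J t) \<le> 1"
  shows "\<exists>\<iota>. inj_on \<iota> {t \<in> T. 0 < J t} \<and> (\<forall>t\<in>T. 0 < J t \<longrightarrow> (real (\<iota> t) + 1) * J t \<le> 1)"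
proof -
  define R where "R t = {s \<in> T. J t < J s \<or> J s = J t \<and> s < t}" for t
  have bound: "real (card F) * J t \<le> 1" if "F \<subseteq> insert t (R t)" "finite F" "t \<in> T" for F t
  proof -
    have "real (card F) * J t = (\<Sum>s\<in>F. J t)" by simp
    also have "\<dots> \<le> (\<Sum>s\<in>F. J s)" using that by (intro sum_mono) (auto simp: R_def)
    also have "\<dots> \<le> 1" using that by (intro sum) (auto simp: R_def)
    finally show ?thesis .
  qed
  have finR: "finite (R t)" if t: "t \<in> T" "0 < J t" for t
  proof -
    have "card F \<le> nat \<lfloor>1 / J t\<rfloor>" if "F \<subseteq> R t" "finite F" for F
    proof -
      have "real (card F) \<le> 1 / J t"
        using bound[of F t] that t by (auto simp: field_simps)
      then show ?thesis by (simp add: le_nat_floor)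
    qed
    then show ?thesis using finite_if_finite_subsets_card_bdd by blast
  qed
  have strict: "card (R s) < card (R t)"
    if "t \<in> T" "0 < J t" "s \<in> R t" for s t
  proof (rule psubset_card_mono[OF finR[OF that(1,2)]])
    have "R s \<subseteq> R t"
    proof
      fix r assume "r \<in> R s"
      then show "r \<in> R t"
        using that(3) unfolding R_def mem_Collect_eq by (smt (verit))
    qed
    moreover have "s \<notin> R s" by (simp add: R_def)
    ultimately show "R s \<subset> R t" using that(3) by (intro psubsetI) auto
  qed
  show ?thesis
  proof (intro exI[of _ "\<lambda>t. card (R t)"] conjI ballI impI inj_onI)
    fix s t assume st: "s \<in> {t \<in> T. 0 < J t}" "t \<in> {t \<in> T. 0 < J t}" "card (R s) = card (R t)"
    then have "s \<notin> R t" "t \<notin> R s" using strict[of t s] strict[of s t] by auto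
    then have "\<not> J t < J s" "\<not> (J s = J t \<and> s < t)" "\<not> J s < J t" "\<not> (J t = J s \<and> t < s)"
      using st(1,2) unfolding R_def by blast+
    then show "s = t" by linarith
  next
    fix t assume t: "t \<in> T" "0 < J t"
    have "t \<notin> R t" by (simp add: R_def)
    then have "card (insert t (R t)) = card (R t) + 1" using finR[OF t] by simp
    then show "(real (card (R t)) + 1) * J t \<le> 1"
      using bound[of "insert t (R t)" t] finR[OF t] t by (simp add: add.commute)
  qed
qed

context
  fixes T :: "real set" and B :: "'b set" and lt :: "'b \<Rightarrow> 'b \<Rightarrow> bool"
begin

text \<open>In the sequence of elements of the Helly space, the indices \<open>0\<close> and \<open>1\<close> carry the two bounds,
  and the even and odd indices from \<open>2\<close> on carry the two functions whose differences are the marks.\<close>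

definition lower :: "(nat \<Rightarrow> (nat \<Rightarrow> real) \<Rightarrow> real) \<times> 'c \<Rightarrow> real \<Rightarrow> real" where
  "lower z t = fst z 0 (\<lambda>_. t)"

definition upper :: "(nat \<Rightarrow> (nat \<Rightarrow> real) \<Rightarrow> real) \<times> 'c \<Rightarrow> real \<Rightarrow> real" where
  "upper z t = fst z 1 (\<lambda>_. t)"

definition mark :: "(nat \<Rightarrow> (nat \<Rightarrow> real) \<Rightarrow> real) \<times> 'c \<Rightarrow> nat \<Rightarrow> real \<Rightarrow> real" where
  "mark z n t = fst z (2 * n + 2) (\<lambda>_. t) - fst z (2 * n + 3) (\<lambda>_. t)"

definition code_space where
  "code_space = prod_topology (product_topology (\<lambda>_::nat. helly_space) UNIV)
     (product_topology (\<lambda>_::nat. increasing_space B lt) UNIV)"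

text \<open>Besides the order of the bounds, the conditions say that the marks are disjointly supported with values in \<open>{0, 1}\<close>, and that
  every point whose jump exceeds \<open>1 / (k + 1)\<close> is marked by an index below \<open>k\<close>; each is an equation
  or a weak inequality between finitely many coordinates, or a finite disjunction of such.\<close>

definition codes where
  "codes = {z \<in> topspace code_space. \<forall>t. t \<in> T \<longrightarrow>
     lower z t \<le> upper z t \<and>
     (\<forall>s. s \<in> T \<longrightarrow> s < t \<longrightarrow> upper z s \<le> lower z t) \<and>
     (\<forall>n. mark z n t = 0 \<or> mark z n t = 1) \<and>
     (\<forall>m n. m \<noteq> n \<longrightarrow> mark z m t = 0 \<or> mark z n t = 0) \<and>
     (\<forall>k. upper z t - lower z t \<le> 1 / (real k + 1) \<or> (\<exists>n<k. mark z n t = 1))}"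

definition decode where
  "decode z = (\<lambda>p\<in>T \<times> B. if \<exists>n. mark z n (fst p) = 1
     then lower z (fst p) + (upper z (fst p) - lower z (fst p)) * snd z (SOME n. mark z n (fst p) = 1) (snd p)
     else lower z (fst p))"

lemma helly_image_code_space:
  "helly_image (increasing_space B lt) \<Longrightarrow> helly_image code_space"
  unfolding code_space_def by (intro helly_image_prod helly_image_helly_power helly_image_power)

lemma continuous_map_code_helly:
  assumes "t \<in> {0..1}"
  shows "continuous_map code_space euclideanreal (\<lambda>z. fst z n (\<lambda>_. t))"
  using continuous_map_compose[OF continuous_map_fst
      continuous_map_coordinate[OF continuous_map_helly_eval[OF assms], of n UNIV]]
  by (simp add: code_space_def o_def)

lemma continuous_map_code_increasing:
  assumes "x \<in> B"
  shows "continuous_map code_space euclideanreal (\<lambda>z. snd z n x)"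
  using continuous_map_compose[OF continuous_map_snd
      continuous_map_coordinate[OF continuous_map_increasing_eval[OF assms], of n UNIV]]
  by (simp add: code_space_def o_def)

lemma continuous_map_lower: "t \<in> {0..1} \<Longrightarrow> continuous_map code_space euclideanreal (\<lambda>z. lower z t)"
  unfolding lower_def by (rule continuous_map_code_helly)

lemma continuous_map_upper: "t \<in> {0..1} \<Longrightarrow> continuous_map code_space euclideanreal (\<lambda>z. upper z t)"
  unfolding upper_def by (rule continuous_map_code_helly)

lemma continuous_map_mark: "t \<in> {0..1} \<Longrightarrow> continuous_map code_space euclideanreal (\<lambda>z. mark z n t)"
  unfolding mark_def by (intro continuous_map_diff continuous_map_code_helly)

lemma closedin_codes:
  assumes "T \<subseteq> {0..1}"
  shows "closedin code_space codes"
  unfolding codes_def using assms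
  by (intro closedin_Collect continuous_map_diff continuous_map_lower continuous_map_upper
      continuous_map_mark) auto

lemma codesD:
  assumes "z \<in> codes" "t \<in> T"
  shows "lower z t \<le> upper z t"
    and "s \<in> T \<Longrightarrow> s < t \<Longrightarrow> upper z s \<le> lower z t"
    and "mark z n t = 0 \<or> mark z n t = 1"
    and "m \<noteq> n \<Longrightarrow> mark z m t = 0 \<or> mark z n t = 0"
    and "upper z t - lower z t \<le> 1 / (real k + 1) \<or> (\<exists>n<k. mark z n t = 1)"
  using assms unfolding codes_def by blast+

lemma decode_eq:
  assumes z: "z \<in> codes" and t: "t \<in> T" and x: "x \<in> B" and n: "mark z n t = 1"
  shows "decode z (t, x) = lower z t + (upper z t - lower z t) * snd z n x"
proof -
  have "m = n" if "mark z m t = 1" for m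
    using codesD(4)[OF z t, of m n] n that by auto
  then have "(SOME m. mark z m t = 1) = n" using n by blast
  then show ?thesis using t x n by (auto simp: decode_def)
qed

lemma decode_eq_lower:
  assumes "t \<in> T" "x \<in> B" "\<And>n. mark z n t \<noteq> 1"
  shows "decode z (t, x) = lower z t"
  using assms by (simp add: decode_def)

lemma code_bounds:
  assumes "z \<in> codes"
  shows "t \<in> {0..1} \<Longrightarrow> 0 \<le> lower z t" "t \<in> {0..1} \<Longrightarrow> upper z t \<le> 1"
    and "x \<in> B \<Longrightarrow> 0 \<le> snd z n x" "x \<in> B \<Longrightarrow> snd z n x \<le> 1"
proof -
  have "fst z n \<in> helly_functions" "snd z n \<in> increasing_functions B lt" for n
    using assms by (auto simp: codes_def code_space_def PiE_iff)
  then show "t \<in> {0..1} \<Longrightarrow> 0 \<le> lower z t" "t \<in> {0..1} \<Longrightarrow> upper z t \<le> 1"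
    "x \<in> B \<Longrightarrow> 0 \<le> snd z n x" "x \<in> B \<Longrightarrow> snd z n x \<le> 1"
    using helly_functions_bounds increasing_functions_bounds[of "snd z n"]
    unfolding lower_def upper_def by (meson atLeastAtMost_iff)+
qed

lemma decode_bounds:
  assumes z: "z \<in> codes" and t: "t \<in> T" and x: "x \<in> B"
  shows "lower z t \<le> decode z (t, x)" "decode z (t, x) \<le> upper z t"
proof -
  have le: "lower z t \<le> upper z t" using z t by (simp add: codes_def)
  have "lower z t \<le> decode z (t, x) \<and> decode z (t, x) \<le> upper z t"
  proof (cases "\<exists>n. mark z n t = 1")
    case True
    then obtain n where n: "mark z n t = 1" by blast
    have "0 \<le> (upper z t - lower z t) * snd z n x"
      using le code_bounds(3)[OF z x] by simp
    moreover have "(upper z t - lower z t) * snd z n x \<le> upper z t - lower z t"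
      using le code_bounds(4)[OF z x] by (simp add: mult_left_le)
    ultimately show ?thesis using decode_eq[OF z t x n] by simp
  next
    case False
    then show ?thesis using decode_eq_lower[OF t x] le by simp
  qed
  then show "lower z t \<le> decode z (t, x)" "decode z (t, x) \<le> upper z t" by auto
qed

lemma decode_in_increasing_functions:
  assumes z: "z \<in> codes" and T: "T \<subseteq> {0..1}"
  shows "decode z \<in> increasing_functions (T \<times> B) (lex_pair lt)"
proof -
  have "decode z (t, x) \<in> {0..1}" if "t \<in> T" "x \<in> B" for t x
    using decode_bounds[OF z that] code_bounds(1,2)[OF z, of t] that T by fastforce
  moreover have "decode z (s, x) \<le> decode z (t, y)"
    if lt: "lex_pair lt (s, x) (t, y)" and B: "s \<in> T" "x \<in> B" "t \<in> T" "y \<in> B" for s x t y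
  proof (cases "s < t")
    case True
    then have "upper z s \<le> lower z t" using z B by (simp add: codes_def)
    then show ?thesis using decode_bounds[OF z] B by (meson order_trans)
  next
    case False
    then have st: "s = t" "lt x y" using lt by (auto simp: lex_pair_def)
    show ?thesis
    proof (cases "\<exists>n. mark z n t = 1")
      case True
      then obtain n where n: "mark z n t = 1" by blast
      have "snd z n \<in> increasing_functions B lt"
        using z by (auto simp: codes_def code_space_def PiE_iff)
      then have "snd z n x \<le> snd z n y" using st B by (auto simp: increasing_functions_def)
      moreover have "lower z t \<le> upper z t" using z B by (simp add: codes_def)
      ultimately show ?thesis
        using decode_eq[OF z _ _ n] st B by (simp add: mult_left_mono)
    next
      case False
      then show ?thesis using st B decode_eq_lower by simp
    qed
  qed
  moreover have "decode z \<in> extensional (T \<times> B)" by (simp add: decode_def)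
  ultimately show ?thesis by (auto simp: increasing_functions_def PiE_iff simp del: atLeastAtMost_iff)
qed

text \<open>Looking only at the marks with index below \<open>k\<close> gives a continuous function of the code. It differs
  from the decoded value only at points that are unmarked so far, and there both lie between the lower
  and the upper bound, which are at distance at most \<open>1 / (k + 1)\<close>.\<close>

lemma continuous_map_decode:
  assumes T: "T \<subseteq> {0..1}"
  shows "continuous_map (subtopology code_space codes) (increasing_space (T \<times> B) (lex_pair lt)) decode"
proof (rule continuous_map_into_increasing_space)
  fix p assume "p \<in> T \<times> B"
  then obtain t x where p: "p = (t, x)" and t: "t \<in> T" and x: "x \<in> B" by auto
  have t01: "t \<in> {0..1}" using t T by auto
  let ?X = "subtopology code_space codes"
  let ?\<sigma> = "\<lambda>k z. lower z t + (upper z t - lower z t) * (\<Sum>n<k. mark z n t * snd z n x)"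
  have approx: "dist (?\<sigma> k z) (decode z (t, x)) \<le> 1 / (real k + 1)" if z: "z \<in> codes" for k z
  proof (cases "\<exists>n<k. mark z n t = 1")
    case True
    then obtain m where m: "m < k" "mark z m t = 1" by blast
    have "mark z n t * snd z n x = (if n = m then snd z m x else 0)" for n
      using codesD(4)[OF z t, of n m] m by auto
    then have "(\<Sum>n<k. mark z n t * snd z n x) = snd z m x" using m by simp
    then show ?thesis using decode_eq[OF z t x m(2)] by simp
  next
    case False
    then have "mark z n t = 0" if "n < k" for n using codesD(3)[OF z t, of n] that by blast
    then have "?\<sigma> k z = lower z t" by simp
    moreover have "upper z t - lower z t \<le> 1 / (real k + 1)"
      using codesD(5)[OF z t] False by blast
    ultimately show ?thesis using decode_bounds[OF z t x] by (simp only: dist_real_def)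
  qed
  have "continuous_map ?X Met_TC.mtopology (\<lambda>z. decode z (t, x))"
  proof (rule Met_TC.continuous_map_uniform_limit)
    show "\<forall>\<^sub>F k in sequentially. continuous_map ?X Met_TC.mtopology (?\<sigma> k)"
      unfolding mtopology_is_euclidean
      by (intro always_eventually allI continuous_map_from_subtopology continuous_map_add
          continuous_map_real_mult continuous_map_diff continuous_map_sum continuous_map_lower
          continuous_map_upper continuous_map_mark continuous_map_code_increasing t01 x) simp
    fix e :: real assume "0 < e"
    have "\<forall>\<^sub>F k in sequentially. 1 / (real k + 1) < e"
    proof -
      obtain N where N: "inverse (real (Suc N)) < e" using \<open>0 < e\<close> reals_Archimedean by blast
      have "1 / (real k + 1) < e" if "N \<le> k" for k
      proof -
        have "1 / (real k + 1) \<le> 1 / (real N + 1)" using that by (intro divide_left_mono) auto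
        then show ?thesis using N by (simp add: inverse_eq_divide add.commute)
      qed
      then show ?thesis by (auto simp: eventually_sequentially)
    qed
    then show "\<forall>\<^sub>F k in sequentially. \<forall>z\<in>topspace ?X.
        decode z (t, x) \<in> UNIV \<and> dist (?\<sigma> k z) (decode z (t, x)) < e"
      by (rule eventually_mono) (use approx in \<open>fastforce intro: le_less_trans\<close>)
  qed simp
  then show "continuous_map ?X euclideanreal (\<lambda>z. decode z p)" by (simp add: p)
qed (use decode_in_increasing_functions[OF _ T] in auto)

text \<open>Rescaling the fibre over \<open>t\<close> to an increasing function with values in \<open>[0,1]\<close> needs a positive jump.
  Over every other point \<open>f\<close> is squeezed between equal bounds, and so is the decoded function.\<close>

lemma decode_surj:
  assumes T: "T \<subseteq> {0..1}" and B: "B \<noteq> {}"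
    and f: "f \<in> increasing_functions (T \<times> B) (lex_pair lt)"
  shows "f \<in> decode ` codes"
proof -
  define a where "a t = (INF x\<in>B. f (t, x))" for t
  define b where "b t = (SUP x\<in>B. f (t, x))" for t
  have f01: "0 \<le> f (t, x)" "f (t, x) \<le> 1" if "t \<in> T" "x \<in> B" for t x
    using increasing_functions_bounds[OF f, of "(t, x)"] that by auto
  have bdd: "bdd_below ((\<lambda>x. f (t, x)) ` B)" "bdd_above ((\<lambda>x. f (t, x)) ` B)" if "t \<in> T" for t
    using f01[OF that] by (meson bdd_belowI2, meson bdd_aboveI2)
  have a_le: "a t \<le> f (t, x)" and le_b: "f (t, x) \<le> b t" if "t \<in> T" "x \<in> B" for t x
    using bdd[OF that(1)] that(2) by (auto simp: a_def b_def intro: cINF_lower cSUP_upper)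
  obtain x0 where x0: "x0 \<in> B" using B by blast
  have ab: "a t \<le> b t" if "t \<in> T" for t using a_le[OF that x0] le_b[OF that x0] by simp
  have a0: "0 \<le> a t" and b1: "b t \<le> 1" if "t \<in> T" for t
    using f01[OF that] B by (auto simp: a_def b_def intro: cINF_greatest cSUP_least)
  have gap: "b s \<le> a t" if "s \<in> T" "t \<in> T" "s < t" for s t
    unfolding b_def
  proof (rule cSUP_least[OF B])
    fix x assume x: "x \<in> B"
    show "f (s, x) \<le> a t"
      unfolding a_def using f that x B
      by (intro cINF_greatest) (auto simp: increasing_functions_def lex_pair_def)
  qed
  define J where "J t = b t - a t" for t
  have "(\<Sum>t\<in>F. J t) \<le> 1" if "finite F" "F \<subseteq> T" for F
    unfolding J_def using that a0 gap b1 by (intro sum_disjoint_jumps[of F T a b]) auto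
  then obtain \<iota> where inj: "inj_on \<iota> {t \<in> T. 0 < J t}"
    and \<iota>: "\<And>t. t \<in> T \<Longrightarrow> 0 < J t \<Longrightarrow> (real (\<iota> t) + 1) * J t \<le> 1"
    using bounded_rank_enumeration[of T J] by blast
  define D where "D = {t \<in> T. 0 < J t}"
  have "\<exists>g\<in>helly_functions. \<forall>t\<in>T. g (\<lambda>_. t) = a t"
  proof (rule helly_interpolation)
    show "t \<in> {0..1}" if "t \<in> T" for t using T that by blast
    show "a t \<in> {0..1}" if "t \<in> T" for t using a0[OF that] b1[OF that] ab[OF that] by simp
    show "a s \<le> a t" if "s \<in> T" "t \<in> T" "s \<le> t" for s t
      using gap[of s t] ab[of s] that by (cases "s = t") auto
  qed
  then obtain \<phi>0 where \<phi>0: "\<phi>0 \<in> helly_functions" "\<And>t. t \<in> T \<Longrightarrow> \<phi>0 (\<lambda>_. t) = a t" by blast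
  have "\<exists>g\<in>helly_functions. \<forall>t\<in>T. g (\<lambda>_. t) = b t"
  proof (rule helly_interpolation)
    show "t \<in> {0..1}" if "t \<in> T" for t using T that by blast
    show "b t \<in> {0..1}" if "t \<in> T" for t using a0[OF that] b1[OF that] ab[OF that] by simp
    show "b s \<le> b t" if "s \<in> T" "t \<in> T" "s \<le> t" for s t
      using gap[of s t] ab[of t] that by (cases "s = t") auto
  qed
  then obtain \<phi>1 where \<phi>1: "\<phi>1 \<in> helly_functions" "\<And>t. t \<in> T \<Longrightarrow> \<phi>1 (\<lambda>_. t) = b t" by blast
  \<comment> \<open>\<open>\<tau> n\<close> is the point of rank \<open>n\<close>; the value \<open>2\<close> lies outside \<open>[0,1]\<close>, so that the \<open>n\<close>-th mark
  vanishes if there is no such point.\<close>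
  define \<tau> where "\<tau> n = (if n \<in> \<iota> ` D then inv_into D \<iota> n else 2)" for n
  have \<tau>\<iota>: "\<tau> (\<iota> t) = t" if "t \<in> D" for t
    using inj that by (simp add: \<tau>_def D_def[symmetric])
  have \<tau>D: "\<tau> n \<in> D \<and> \<iota> (\<tau> n) = n" if "\<tau> n \<in> T" for n
  proof (cases "n \<in> \<iota> ` D")
    case True
    then show ?thesis by (simp add: \<tau>_def inv_into_into f_inv_into_f)
  next
    case False
    then show ?thesis using that T by (auto simp: \<tau>_def)
  qed
  \<comment> \<open>The difference \<open>p n - q n\<close> is the indicator of \<open>\<tau> n\<close>.\<close>
  define p where "p n = helly_of (\<lambda>s. if \<tau> n \<le> s then 1 else 0)" for n
  define q where "q n = helly_of (\<lambda>s. if \<tau> n < s then 1 else 0)" for n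
  have pq: "p n \<in> helly_functions" "q n \<in> helly_functions" for n
    unfolding p_def q_def by (auto intro!: helly_of_in_helly_functions mono_onI)
  define \<phi> where "\<phi> k = (if k = 0 then \<phi>0 else if k = 1 then \<phi>1
      else if even k then p ((k - 2) div 2) else q ((k - 3) div 2))" for k :: nat
  have \<phi>_simps: "\<phi> 0 = \<phi>0" "\<phi> 1 = \<phi>1" "\<phi> (2 * n + 2) = p n" "\<phi> (2 * n + 3) = q n" for n
    by (auto simp: \<phi>_def)
  have \<phi>_in: "\<phi> k \<in> helly_functions" for k using \<phi>0(1) \<phi>1(1) pq by (simp add: \<phi>_def)
  define h where "h n = (\<lambda>x\<in>B. if \<tau> n \<in> T then (f (\<tau> n, x) - a (\<tau> n)) / J (\<tau> n) else 0)" for n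
  have h_in: "h n \<in> increasing_functions B lt" for n
  proof (cases "\<tau> n \<in> T")
    case True
    then have J: "0 < J (\<tau> n)" using \<tau>D by (auto simp: D_def)
    have "h n x \<in> {0..1}" if "x \<in> B" for x
      using J a_le[OF True that] le_b[OF True that] that True by (simp add: h_def J_def field_simps)
    moreover have "h n x \<le> h n y" if "x \<in> B" "y \<in> B" "lt x y" for x y
      using f True that J
      by (auto simp: h_def increasing_functions_def lex_pair_def intro!: divide_right_mono)
    ultimately show ?thesis
      by (auto simp: increasing_functions_def h_def PiE_iff simp del: atLeastAtMost_iff)
  next
    case False
    then show ?thesis by (auto simp: h_def increasing_functions_def)
  qed
  let ?z = "(\<phi>, h)"
  have lower: "lower ?z t = a t" and upper: "upper ?z t = b t" if "t \<in> T" for t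
    using \<phi>0(2) \<phi>1(2) that by (simp_all add: lower_def upper_def \<phi>_simps del: One_nat_def)
  have mark: "mark ?z n t = (if t = \<tau> n then 1 else 0)" if "t \<in> T" for n t
    using that T unfolding mark_def fst_conv \<phi>_simps by (auto simp: p_def q_def subset_iff)
  have z: "?z \<in> codes"
    unfolding codes_def
  proof (intro CollectI conjI allI impI)
    show "?z \<in> topspace code_space" using \<phi>_in h_in by (simp add: code_space_def PiE_UNIV_domain)
    fix t assume t: "t \<in> T"
    show "lower ?z t \<le> upper ?z t" using lower upper ab t by simp
    show "upper ?z s \<le> lower ?z t" if "s \<in> T" "s < t" for s using lower upper gap t that by simp
    show "mark ?z n t = 0 \<or> mark ?z n t = 1" for n using mark[OF t] by simp
    show "mark ?z m t = 0 \<or> mark ?z n t = 0" if "m \<noteq> n" for m n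
      using mark[OF t] \<tau>D t that by metis
    show "upper ?z t - lower ?z t \<le> 1 / (real k + 1) \<or> (\<exists>n<k. mark ?z n t = 1)" for k
    proof (cases "J t \<le> 1 / (real k + 1)")
      case True
      then show ?thesis using lower upper t by (simp add: J_def)
    next
      case False
      then have J: "1 < (real k + 1) * J t" by (simp add: field_simps)
      have J0: "0 < J t" using False by (smt (verit) divide_nonneg_nonneg of_nat_0_le_iff)
      have "(real (\<iota> t) + 1) * J t < (real k + 1) * J t" using \<iota>[OF t J0] J by simp
      then have "\<iota> t < k" using J0 by simp
      moreover have "mark ?z (\<iota> t) t = 1" using mark[OF t] \<tau>\<iota>[of t] t J0 by (simp add: D_def)
      ultimately show ?thesis by blast
    qed
  qed
  have "decode ?z (t, x) = f (t, x)" if t: "t \<in> T" and x: "x \<in> B" for t x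
  proof (cases "0 < J t")
    case True
    then have \<tau>: "\<tau> (\<iota> t) = t" using \<tau>\<iota> t by (simp add: D_def)
    then have "mark ?z (\<iota> t) t = 1" using mark[OF t] by simp
    then show ?thesis
      using decode_eq[OF z t x] \<tau> t x True lower upper by (simp add: h_def J_def)
  next
    case False
    then have "a t = b t" using ab[OF t] by (simp add: J_def)
    then show ?thesis
      using decode_bounds[OF z t x] a_le[OF t x] le_b[OF t x] lower[OF t] upper[OF t] by simp
  qed
  moreover have "f \<in> extensional (T \<times> B)" "decode ?z \<in> extensional (T \<times> B)"
    using f by (auto simp: increasing_functions_def decode_def PiE_iff)
  ultimately have "f = decode ?z" by (intro extensionalityI[of f "T \<times> B"]) auto
  then show ?thesis using z by blast
qed

lemma helly_image_lex_product:
  assumes "T \<subseteq> {0..1}" "B \<noteq> {}" "helly_image (increasing_space B lt)"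
  shows "helly_image (increasing_space (T \<times> B) (lex_pair lt))"
proof (rule helly_image_of_closed[OF helly_image_code_space[OF assms(3)] closedin_codes[OF assms(1)]
      continuous_map_decode[OF assms(1)]])
  show "decode ` codes = topspace (increasing_space (T \<times> B) (lex_pair lt))"
    using decode_in_increasing_functions[OF _ assms(1)] decode_surj[OF assms(1,2)]
    unfolding topspace_increasing_space by blast
qed

end

section \<open>Ordinals below \<open>\<omega> \<cdot> \<omega>\<close>\<close>

lemma H_space_eq_increasing_space: "H_space r = increasing_space (cube r) (lex_less r)"
  by (simp add: H_space_def increasing_space_def monotone_functions_def increasing_functions_def)

text \<open>An embedding of \<open>{0,1}\<close>-sequences with the lexicographic order into \<open>[0,1]\<close>. The base \<open>3\<close> makes it
  strictly increasing: all later digits together weigh at most half of the first digit that differs.\<close>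

definition ternary :: "(nat \<Rightarrow> nat) \<Rightarrow> real" where
  "ternary \<rho> = (\<Sum>i. real (\<rho> i) * (1 / 3) ^ (i + 1))"

lemma summable_ternary:
  assumes "\<rho> \<in> UNIV \<rightarrow> {0, 1}"
  shows "summable (\<lambda>i. real (\<rho> i) * (1 / 3) ^ (i + 1))"
proof (rule summable_comparison_test'[of "\<lambda>i. (1 / 3) ^ (i + 1)" 0])
  show "summable (\<lambda>i. (1 / 3 :: real) ^ (i + 1))"
    using summable_mult[OF summable_geometric[of "1 / 3 :: real"], of "1 / 3"] by simp
  show "norm (real (\<rho> i) * (1 / 3) ^ (i + 1)) \<le> (1 / 3) ^ (i + 1)" for i
  proof -
    have "\<rho> i = 0 \<or> \<rho> i = 1" using assms by auto
    then show ?thesis by auto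
  qed
qed

lemma sums_third_tail: "(\<lambda>i. (1 / 3 :: real) ^ (i + k + 1)) sums ((1 / 3) ^ k / 2)"
  using sums_mult[OF geometric_sums[of "1 / 3 :: real"], of "(1 / 3) ^ (k + 1)"]
  by (simp add: power_add mult.commute mult.left_commute field_simps)

lemma ternary_less:
  assumes \<rho>: "\<rho> \<in> UNIV \<rightarrow> {0, 1}" and \<sigma>: "\<sigma> \<in> UNIV \<rightarrow> {0, 1}"
    and eq: "\<And>i. i < j \<Longrightarrow> \<rho> i = \<sigma> i" and less: "\<rho> j < \<sigma> j"
  shows "ternary \<rho> < ternary \<sigma>"
proof -
  define d where "d i = real (\<sigma> i) * (1 / 3) ^ (i + 1) - real (\<rho> i) * (1 / 3) ^ (i + 1)" for i
  have d: "d sums (ternary \<sigma> - ternary \<rho>)"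
    unfolding d_def[abs_def] ternary_def
    by (intro sums_diff summable_sums summable_ternary \<rho> \<sigma>)
  have tail: "(\<lambda>i. d (i + Suc j)) sums (ternary \<sigma> - ternary \<rho> - (\<Sum>i<Suc j. d i))"
    using d by (rule sums_split_initial_segment)
  have head: "(\<Sum>i<Suc j. d i) = (1 / 3) ^ (j + 1)"
  proof -
    have "\<sigma> j = 1" "\<rho> j = 0" using less \<rho> \<sigma> by (auto simp: Pi_iff) (metis less_one not_less0 less_irrefl)+
    moreover have "(\<Sum>i<j. d i) = 0" using eq by (simp add: d_def)
    ultimately show ?thesis by (simp add: d_def)
  qed
  have "- ((1 / 3) ^ (i + Suc j + 1)) \<le> d (i + Suc j)" for i
  proof -
    have "real (\<rho> (i + Suc j)) \<le> 1" using \<rho> by (auto simp: Pi_iff le_Suc_eq)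
    then have "real (\<rho> (i + Suc j)) * (1 / 3) ^ (i + Suc j + 1) \<le> (1 / 3) ^ (i + Suc j + 1)"
      by (intro mult_left_le_one_le) simp_all
    moreover have "0 \<le> real (\<sigma> (i + Suc j)) * (1 / 3) ^ (i + Suc j + 1)" by simp
    ultimately show ?thesis unfolding d_def by linarith
  qed
  then have "- ((1 / 3) ^ Suc j / 2) \<le> ternary \<sigma> - ternary \<rho> - (1 / 3) ^ (j + 1)"
    using tail unfolding head by (rule sums_le[OF _ sums_minus[OF sums_third_tail]])
  moreover have "(0::real) < (1 / 3) ^ (j + 1)" by simp
  ultimately show ?thesis unfolding Suc_eq_plus1 by linarith
qed

lemma ternary_less_iff:
  assumes \<rho>: "\<rho> \<in> UNIV \<rightarrow> {0, 1}" and \<sigma>: "\<sigma> \<in> UNIV \<rightarrow> {0, 1}"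
  shows "ternary \<rho> < ternary \<sigma> \<longleftrightarrow> (\<exists>j. (\<forall>i<j. \<rho> i = \<sigma> i) \<and> \<rho> j < \<sigma> j)"
    and "ternary \<rho> = ternary \<sigma> \<longleftrightarrow> \<rho> = \<sigma>"
proof -
  have cmp: "\<rho> = \<sigma> \<or> (\<exists>j. (\<forall>i<j. \<rho> i = \<sigma> i) \<and> \<rho> j < \<sigma> j) \<or> (\<exists>j. (\<forall>i<j. \<sigma> i = \<rho> i) \<and> \<sigma> j < \<rho> j)"
  proof (cases "\<rho> = \<sigma>")
    case False
    then obtain k where "\<rho> k \<noteq> \<sigma> k" by auto
    then obtain j where "\<rho> j \<noteq> \<sigma> j" "\<forall>i<j. \<rho> i = \<sigma> i"
      using exists_least_iff[of "\<lambda>k. \<rho> k \<noteq> \<sigma> k"] by blast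
    then show ?thesis by (metis linorder_neqE_nat)
  qed simp
  show "ternary \<rho> < ternary \<sigma> \<longleftrightarrow> (\<exists>j. (\<forall>i<j. \<rho> i = \<sigma> i) \<and> \<rho> j < \<sigma> j)"
    using cmp ternary_less[OF \<rho> \<sigma>] ternary_less[OF \<sigma> \<rho>] by (metis less_asym less_irrefl)
  show "ternary \<rho> = ternary \<sigma> \<longleftrightarrow> \<rho> = \<sigma>"
    using cmp ternary_less[OF \<rho> \<sigma>] ternary_less[OF \<sigma> \<rho>] by (metis less_irrefl)
qed

lemma ternary_bounds:
  assumes "\<rho> \<in> UNIV \<rightarrow> {0, 1}"
  shows "ternary \<rho> \<in> {0..1}"
proof -
  have s: "(\<lambda>i. real (\<rho> i) * (1 / 3) ^ (i + 1)) sums ternary \<rho>"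
    unfolding ternary_def by (intro summable_sums summable_ternary assms)
  have \<rho>: "\<rho> i = 0 \<or> \<rho> i = 1" for i using assms by auto
  have le: "real (\<rho> i) * (1 / 3) ^ (i + 1) \<le> (1 / 3) ^ (i + 0 + 1)" for i
    using \<rho>[of i] by auto
  have "0 \<le> ternary \<rho>" using sums_le[OF _ sums_zero s] by simp
  moreover have "ternary \<rho> \<le> 1" using sums_le[OF le s sums_third_tail[of 0]] by simp
  ultimately show ?thesis by simp
qed

text \<open>The initial segment of \<open>\<omega> \<cdot> \<omega>\<close> below \<open>(n, m)\<close>, of order type \<open>\<omega> \<cdot> n + m\<close>.\<close>

definition initial :: "nat \<Rightarrow> nat \<Rightarrow> (nat \<times> nat) set" where
  "initial n m = {p. fst p < n \<or> fst p = n \<and> snd p < m}"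

definition omega_mult_plus :: "nat \<Rightarrow> nat \<Rightarrow> (nat \<times> nat) rel" where
  "omega_mult_plus n m = Restr omega_times_omega (initial n m)"

lemma Field_omega_mult_plus [simp]: "Field (omega_mult_plus n m) = initial n m"
  by (auto simp: omega_mult_plus_def Field_def omega_times_omega_def)

lemma underS_omega_mult_plus:
  "q \<in> initial n m \<Longrightarrow> underS (omega_mult_plus n m) q =
     {p \<in> initial n m. fst p < fst q \<or> fst p = fst q \<and> snd p < snd q}"
  by (cases q) (auto simp: underS_def omega_mult_plus_def omega_times_omega_iff)

lemma helly_image_H_space_finite: "helly_image (H_space (omega_mult_plus 0 m))"
proof -
  have "initial 0 m = {0} \<times> {..<m}" by (auto simp: initial_def)
  then have "finite (cube (omega_mult_plus 0 m))" by (simp add: cube_def finite_PiE)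
  then show ?thesis
    unfolding H_space_eq_increasing_space
    by (intro helly_image_increasing_space_countable countable_finite)
qed

text \<open>Since \<open>\<omega> \<cdot> (n + 1) + m = \<omega> + (\<omega> \<cdot> n + m)\<close>, a point of the larger cube is a sequence followed by a point
  of the smaller cube. The sequence is compared first, so the larger cube is the lexicographic product
  of a set of reals with the smaller cube.\<close>

lemma helly_image_H_space_step:
  assumes "helly_image (H_space (omega_mult_plus n m))"
  shows "helly_image (H_space (omega_mult_plus (Suc n) m))"
proof -
  let ?r = "omega_mult_plus n m" and ?r' = "omega_mult_plus (Suc n) m"
  define row where "row x j = x (0, j)" for x :: "nat \<times> nat \<Rightarrow> nat" and j :: nat
  define rest where "rest x = (\<lambda>p\<in>initial n m. x (Suc (fst p), snd p))"
    for x :: "nat \<times> nat \<Rightarrow> nat"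
  define h where "h x = (ternary (row x), rest x)" for x
  define T where "T = ternary ` (UNIV \<rightarrow> {0, 1})"
  have T01: "T \<subseteq> {0..1}" unfolding T_def using ternary_bounds by blast
  have ne: "cube ?r \<noteq> {}" by (simp add: cube_def PiE_eq_empty_iff)
  have in0: "(0, j) \<in> initial (Suc n) m" for j by (simp add: initial_def)
  have inSuc: "(Suc i, j) \<in> initial (Suc n) m \<longleftrightarrow> (i, j) \<in> initial n m" for i j
    by (simp add: initial_def)
  have row_in: "row x \<in> UNIV \<rightarrow> {0, 1}" if "x \<in> cube ?r'" for x
    using that in0 by (force simp: cube_def row_def PiE_iff)
  have rest_in: "rest x \<in> cube ?r" if "x \<in> cube ?r'" for x
    using that inSuc by (force simp: cube_def rest_def PiE_iff)
  have bij: "bij_betw h (cube ?r') (T \<times> cube ?r)"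
  proof (rule bij_betw_imageI)
    show "inj_on h (cube ?r')"
    proof (rule inj_onI)
      fix x y assume xy: "x \<in> cube ?r'" "y \<in> cube ?r'" "h x = h y"
      then have "ternary (row x) = ternary (row y)" and rest: "rest x = rest y" by (auto simp: h_def)
      then have row: "row x = row y" using ternary_less_iff(2) row_in xy by blast
      have "x (i, j) = y (i, j)" if p: "(i, j) \<in> initial (Suc n) m" for i j
      proof (cases i)
        case 0
        then show ?thesis using fun_cong[OF row, of j] by (simp add: row_def)
      next
        case (Suc k)
        then show ?thesis using fun_cong[OF rest, of "(k, j)"] p inSuc by (simp add: rest_def)
      qed
      then show "x = y" using xy by (intro PiE_ext[of x _ _ y]) (auto simp: cube_def)
    qed
    show "h ` cube ?r' = T \<times> cube ?r"
    proof
      show "h ` cube ?r' \<subseteq> T \<times> cube ?r" using row_in rest_in by (auto simp: h_def T_def)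
    next
      have "(ternary \<rho>, y) \<in> h ` cube ?r'" if \<rho>: "\<rho> \<in> UNIV \<rightarrow> {0, 1}" and y: "y \<in> cube ?r" for \<rho> y
      proof (rule image_eqI)
        let ?x = "\<lambda>p\<in>initial (Suc n) m. if fst p = 0 then \<rho> (snd p) else y (fst p - 1, snd p)"
        show "?x \<in> cube ?r'"
          unfolding cube_def Field_omega_mult_plus
        proof (rule restrict_PiE_iff[THEN iffD2], rule ballI)
          fix p assume p: "p \<in> initial (Suc n) m"
          show "(if fst p = 0 then \<rho> (snd p) else y (fst p - 1, snd p)) \<in> {0, 1}"
          proof (cases "fst p")
            case 0
            then show ?thesis using \<rho> by auto
          next
            case (Suc k)
            then have "(k, snd p) \<in> initial n m" using p inSuc[of k "snd p"] by (metis prod.collapse)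
            then show ?thesis using Suc y by (auto simp: cube_def dest: PiE_mem)
          qed
        qed
        have "row ?x = \<rho>" using in0 by (auto simp: row_def)
        moreover have "rest ?x = y"
          using y inSuc by (auto simp: rest_def cube_def PiE_iff extensional_def fun_eq_iff)
        ultimately show "(ternary \<rho>, y) = h ?x" by (simp add: h_def)
      qed
      then show "T \<times> cube ?r \<subseteq> h ` cube ?r'" by (auto simp: T_def)
    qed
  qed
  have lex: "lex_less ?r' x y \<longleftrightarrow> lex_pair (lex_less ?r) (h x) (h y)"
    if x: "x \<in> cube ?r'" and y: "y \<in> cube ?r'" for x y
  proof
    assume "lex_less ?r' x y"
    then obtain i j where b: "(i, j) \<in> initial (Suc n) m" "x (i, j) < y (i, j)"
      and eq: "\<And>c. c \<in> underS ?r' (i, j) \<Longrightarrow> x c = y c"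
      by (auto simp: lex_less_def)
    note eq = eq[unfolded underS_omega_mult_plus[OF b(1)]]
    show "lex_pair (lex_less ?r) (h x) (h y)"
    proof (cases i)
      case 0
      have "ternary (row x) < ternary (row y)"
        unfolding ternary_less_iff(1)[OF row_in[OF x] row_in[OF y]]
        using b(2) eq in0 0 by (intro exI[of _ j]) (auto simp: row_def)
      then show ?thesis by (simp add: lex_pair_def h_def)
    next
      case (Suc k)
      have "row x = row y" using eq in0 Suc by (auto simp: row_def)
      moreover have kj: "(k, j) \<in> initial n m" using b(1) Suc inSuc[of k j] by simp
      moreover have "lex_less ?r (rest x) (rest y)"
        unfolding lex_less_def Field_omega_mult_plus
      proof (intro bexI[OF _ kj] conjI ballI)
        show "rest x c = rest y c" if "c \<in> underS ?r (k, j)" for c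
          using that eq[of "(Suc (fst c), snd c)"] Suc inSuc[of "fst c" "snd c"]
          by (auto simp: rest_def underS_omega_mult_plus[OF kj])
        show "rest x (k, j) < rest y (k, j)" using b(2) kj Suc by (simp add: rest_def)
      qed
      ultimately show ?thesis by (simp add: lex_pair_def h_def)
    qed
  next
    assume "lex_pair (lex_less ?r) (h x) (h y)"
    then consider "ternary (row x) < ternary (row y)"
      | "ternary (row x) = ternary (row y)" "lex_less ?r (rest x) (rest y)"
      by (auto simp: lex_pair_def h_def)
    then show "lex_less ?r' x y"
    proof cases
      case 1
      then obtain j where j: "\<forall>i<j. row x i = row y i" "row x j < row y j"
        using ternary_less_iff(1)[OF row_in[OF x] row_in[OF y]] by blast
      then show ?thesis
        unfolding lex_less_def Field_omega_mult_plus
        by (intro bexI[OF _ in0[of j]]) (auto simp: row_def underS_omega_mult_plus[OF in0])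
    next
      case 2
      then have row: "x (0, j) = y (0, j)" for j
        using ternary_less_iff(2)[OF row_in[OF x] row_in[OF y]] by (metis row_def)
      obtain k j where kj: "(k, j) \<in> initial n m" "rest x (k, j) < rest y (k, j)"
        and eq: "\<And>c. c \<in> underS ?r (k, j) \<Longrightarrow> rest x c = rest y c"
        using 2(2) by (auto simp: lex_less_def)
      have kj': "(Suc k, j) \<in> initial (Suc n) m" using kj(1) inSuc by simp
      show ?thesis
        unfolding lex_less_def Field_omega_mult_plus
      proof (intro bexI[OF _ kj'] conjI ballI)
        fix c assume "c \<in> underS ?r' (Suc k, j)"
        then have c: "c \<in> initial (Suc n) m" "fst c < Suc k \<or> fst c = Suc k \<and> snd c < j"
          by (auto simp: underS_omega_mult_plus[OF kj'])
        show "x c = y c"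
        proof (cases "fst c")
          case 0
          then show ?thesis using row[of "snd c"] by (metis prod.collapse)
        next
          case (Suc i)
          then have cc: "c = (Suc i, snd c)" by (simp add: prod_eq_iff)
          then have i: "(i, snd c) \<in> initial n m" using c(1) inSuc[of i "snd c"] by simp
          then have "rest x (i, snd c) = rest y (i, snd c)"
            using c(2) Suc by (intro eq) (auto simp: underS_omega_mult_plus[OF kj(1)])
          then show ?thesis using i by (simp add: rest_def flip: cc)
        qed
      next
        show "x (Suc k, j) < y (Suc k, j)" using kj by (simp add: rest_def)
      qed
    qed
  qed
  have "helly_image (increasing_space (T \<times> cube ?r) (lex_pair (lex_less ?r)))"
    using T01 ne assms unfolding H_space_eq_increasing_space by (rule helly_image_lex_product)
  then show ?thesis
    unfolding H_space_eq_increasing_space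
    using bij lex by (rule helly_image_increasing_space_iso[where lt = "lex_pair (lex_less ?r)" and h = h])
qed

lemma helly_image_H_space_omega_mult_plus: "helly_image (H_space (omega_mult_plus n m))"
  by (induction n) (simp_all add: helly_image_H_space_finite helly_image_H_space_step)

text \<open>Pulling back along an isomorphism of orders identifies the cubes together with their lexicographic
  orders.\<close>

lemma cube_iso:
  assumes "iso r' r f"
  defines "h \<equiv> \<lambda>x. \<lambda>b\<in>Field r'. x (f b)"
  shows "bij_betw h (cube r) (cube r')"
    and "x \<in> cube r \<Longrightarrow> y \<in> cube r \<Longrightarrow> lex_less r x y \<longleftrightarrow> lex_less r' (h x) (h y)"
proof -
  have bij: "bij_betw f (Field r') (Field r)"
    and ord: "\<And>a b. a \<in> Field r' \<Longrightarrow> b \<in> Field r' \<Longrightarrow> (a, b) \<in> r' \<longleftrightarrow> (f a, f b) \<in> r"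
    using assms(1) by (auto simp: iso_iff2)
  have im: "f ` Field r' = Field r" and inj: "inj_on f (Field r')"
    using bij by (auto simp: bij_betw_def)
  let ?k = "inv_into (Field r') f"
  have fk: "?k a \<in> Field r'" "f (?k a) = a" if "a \<in> Field r" for a
    using that im by (auto simp: inv_into_into f_inv_into_f)
  have kf: "?k (f b) = b" "f b \<in> Field r" if "b \<in> Field r'" for b
    using that inj im by auto
  show "bij_betw h (cube r) (cube r')"
  proof (rule bij_betw_byWitness[where f' = "\<lambda>y. \<lambda>a\<in>Field r. y (?k a)"])
    show "\<forall>x\<in>cube r. (\<lambda>a\<in>Field r. h x (?k a)) = x"
      using fk by (auto simp: h_def cube_def PiE_iff extensional_def fun_eq_iff)
    show "\<forall>y\<in>cube r'. h (\<lambda>a\<in>Field r. y (?k a)) = y"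
      using kf by (auto simp: h_def cube_def PiE_iff extensional_def fun_eq_iff)
    show "h ` cube r \<subseteq> cube r'"
      using kf by (force simp: h_def cube_def PiE_iff)
    show "(\<lambda>y. \<lambda>a\<in>Field r. y (?k a)) ` cube r' \<subseteq> cube r"
      using fk by (force simp: cube_def PiE_iff)
  qed
  have under: "underS r (f b) = f ` underS r' b" if b: "b \<in> Field r'" for b
  proof
    show "f ` underS r' b \<subseteq> underS r (f b)"
    proof (rule image_subsetI)
      fix c assume c: "c \<in> underS r' b"
      then have "c \<in> Field r'" by (auto simp: underS_def Field_def)
      then show "f c \<in> underS r (f b)"
        using c b ord inj by (auto simp: underS_def inj_on_def)
    qed
    show "underS r (f b) \<subseteq> f ` underS r' b"
    proof
      fix a assume a: "a \<in> underS r (f b)"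
      then have "a \<in> Field r" by (auto simp: underS_def Field_def)
      then obtain c where c: "c \<in> Field r'" "a = f c" using im by blast
      then show "a \<in> f ` underS r' b" using a b ord by (auto simp: underS_def)
    qed
  qed
  have sub: "underS r' b \<subseteq> Field r'" for b by (auto simp: underS_def Field_def)
  show "lex_less r x y \<longleftrightarrow> lex_less r' (h x) (h y)"
  proof -
    have "lex_less r x y \<longleftrightarrow>
        (\<exists>b\<in>Field r'. (\<forall>c\<in>underS r (f b). x c = y c) \<and> x (f b) < y (f b))"
      unfolding lex_less_def im[symmetric] by auto
    also have "\<dots> \<longleftrightarrow> (\<exists>b\<in>Field r'. (\<forall>c\<in>underS r' b. x (f c) = y (f c)) \<and> x (f b) < y (f b))"
      by (intro bex_cong refl) (simp add: under)
    also have "\<dots> \<longleftrightarrow> lex_less r' (h x) (h y)"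
      unfolding lex_less_def using sub by (intro bex_cong refl) (auto simp: h_def)
    finally show ?thesis .
  qed
qed

section \<open>Extending maps to the Helly space\<close>

text \<open>The coordinates of a map \<open>g\<close> from a closed subset \<open>C\<close> of the Helly space extend, by Tietze's theorem,
  to the whole Helly space. The extensions together map the Helly space onto a compact set \<open>L\<close> in a power of
  the reals, and the image of \<open>C\<close> in \<open>L\<close> is a copy of the given space. The injection \<open>j\<close> renames the
  coordinates, so that \<open>L\<close> consists of functions on sequences of reals; coordinates outside its range are \<open>0\<close>.\<close>

lemma subspace_of_image_increasing_space:
  fixes B :: "'b set" and j :: "'b \<Rightarrow> nat \<Rightarrow> real"
  assumes H: "helly_image (increasing_space B lt)"
    and j: "inj_on j B"
  shows "subspace_of_image_of_separable_Rosenthal_CD (increasing_space B lt)"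
proof -
  obtain C g where C: "closedin helly_space C"
    and g: "continuous_map (subtopology helly_space C) (increasing_space B lt) g"
    and gC: "g ` C = topspace (increasing_space B lt)"
    using H by (auto simp: helly_image_def)
  have normal: "normal_space helly_space"
    by (simp add: compact_Hausdorff_or_regular_imp_normal_space compact_space_helly_space
        Hausdorff_space_helly_space)
  have "\<exists>G. continuous_map helly_space euclideanreal G \<and> (\<forall>c\<in>C. G c = g c x)" if x: "x \<in> B" for x
  proof -
    have "continuous_map (subtopology helly_space C) euclideanreal (\<lambda>c. g c x)"
      using continuous_map_compose[OF g continuous_map_increasing_eval[OF x]] by (simp add: o_def)
    then show ?thesis
      using Tietze_extension_realinterval[OF normal C is_interval_univ] by (metis UNIV_not_empty subset_UNIV)
  qed
  then obtain G where G: "\<And>x. x \<in> B \<Longrightarrow> continuous_map helly_space euclideanreal (G x)"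
    and Gg: "\<And>x c. x \<in> B \<Longrightarrow> c \<in> C \<Longrightarrow> G x c = g c x"
    by metis
  define \<Phi> where "\<Phi> c z = (if z \<in> j ` B then G (inv_into B j z) c else 0)"
    for c :: "(nat \<Rightarrow> real) \<Rightarrow> real" and z
  let ?R = "product_topology (\<lambda>_. euclideanreal) (UNIV :: (nat \<Rightarrow> real) set)"
  let ?L = "subtopology ?R (\<Phi> ` helly_functions)"
  have inv: "inv_into B j (j x) = x" if "x \<in> B" for x using j that by simp
  have "continuous_map helly_space ?R \<Phi>"
    unfolding continuous_map_componentwise_UNIV \<Phi>_def
    using G by (auto simp: inv_into_into)
  then have \<Phi>: "continuous_map helly_space ?L \<Phi>" by (intro continuous_map_into_subtopology) auto
  let ?S = "\<Phi> ` C"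
  have CH: "C \<subseteq> helly_functions" using closedin_subset[OF C] by simp
  define embed where "embed f z = (if z \<in> j ` B then f (inv_into B j z) else 0)"
    for f :: "'b \<Rightarrow> real" and z
  define retract where "retract w = (\<lambda>x\<in>B. w (j x))" for w :: "(nat \<Rightarrow> real) \<Rightarrow> real"
  have embed_g: "embed (g c) = \<Phi> c" if "c \<in> C" for c
    using Gg that by (auto simp: embed_def \<Phi>_def inv_into_into fun_eq_iff)
  have retract_embed: "retract (embed f) = f" if "f \<in> increasing_functions B lt" for f
    using that inv
    by (auto simp: retract_def embed_def increasing_functions_def PiE_iff extensional_def fun_eq_iff)
  have g_in: "g c \<in> increasing_functions B lt" if "c \<in> C" for c using gC that by auto
  have retract_\<Phi>: "retract (\<Phi> c) = g c" if "c \<in> C" for c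
    using retract_embed[OF g_in[OF that]] embed_g[OF that] by simp
  have "homeomorphic_maps (increasing_space B lt) (subtopology ?L ?S) embed retract"
    unfolding homeomorphic_maps_def
  proof (intro conjI ballI)
    have "embed f \<in> \<Phi> ` C" if f: "f \<in> increasing_functions B lt" for f
    proof -
      have "f \<in> g ` C" using gC f by simp
      then show ?thesis using embed_g by (metis (no_types, lifting) imageE imageI)
    qed
    moreover have "continuous_map (increasing_space B lt) ?R embed"
      unfolding continuous_map_componentwise_UNIV embed_def
      by (auto intro!: continuous_map_increasing_eval simp: inv_into_into)
    ultimately show "continuous_map (increasing_space B lt) (subtopology ?L ?S) embed"
      using CH by (intro continuous_map_into_subtopology) auto
    have "continuous_map (subtopology ?L ?S) euclideanreal (\<lambda>w. retract w x)" if "x \<in> B" for x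
      using that unfolding retract_def
      by (simp, intro continuous_map_from_subtopology continuous_map_product_projection) simp
    then show "continuous_map (subtopology ?L ?S) (increasing_space B lt) retract"
      using retract_\<Phi> g_in by (intro continuous_map_into_increasing_space) auto
    show "retract (embed f) = f" if "f \<in> topspace (increasing_space B lt)" for f
      using that retract_embed by simp
    show "embed (retract w) = w" if w: "w \<in> topspace (subtopology ?L ?S)" for w
    proof -
      obtain c where "c \<in> C" "w = \<Phi> c" using w by auto
      then show ?thesis using retract_\<Phi> embed_g by simp
    qed
  qed
  then have "increasing_space B lt homeomorphic_space subtopology ?L ?S"
    unfolding homeomorphic_space_def by blast
  moreover have "Hausdorff_space ?L"
    by (intro Hausdorff_space_subtopology) (simp add: Hausdorff_space_product_topology)
  moreover have "\<Phi> ` topspace helly_space = topspace ?L" "?S \<subseteq> topspace ?L" using CH by auto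
  ultimately show ?thesis
    unfolding subspace_of_image_of_separable_Rosenthal_CD_def
    using separable_space_helly_space Rosenthal_compact_helly_space class_CD_helly_space \<Phi> by blast
qed

theorem proposition9:
  fixes r :: "'a rel"
  assumes "Well_order r" and "(r, omega_times_omega) \<in> ordLess"
  shows "subspace_of_image_of_separable_Rosenthal_CD (H_space r)"
proof -
  obtain n m where "(r, Restr omega_times_omega (underS omega_times_omega (n, m))) \<in> ordIso"
    using assms ordLess_iff_ordIso_Restr[OF Well_order_omega_times_omega assms(1)] by auto
  moreover have "underS omega_times_omega (n, m) = initial n m"
    by (auto simp: underS_def omega_times_omega_iff initial_def)
  ultimately have "(omega_mult_plus n m, r) \<in> ordIso"
    by (simp add: omega_mult_plus_def ordIso_symmetric)
  then obtain f where f: "iso (omega_mult_plus n m) r f" by (auto simp: ordIso_def)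
  define h where "h x = (\<lambda>b\<in>Field (omega_mult_plus n m). x (f b))" for x :: "'a \<Rightarrow> nat"
  have bij: "bij_betw h (cube r) (cube (omega_mult_plus n m))"
    and lex: "\<And>x y. x \<in> cube r \<Longrightarrow> y \<in> cube r \<Longrightarrow>
      lex_less r x y \<longleftrightarrow> lex_less (omega_mult_plus n m) (h x) (h y)"
    using cube_iso[OF f] unfolding h_def by blast+
  have "helly_image (H_space r)"
    unfolding H_space_eq_increasing_space
    using helly_image_H_space_omega_mult_plus[of n m, unfolded H_space_eq_increasing_space] bij lex
    by (rule helly_image_increasing_space_iso[where h = h])
  \<comment> \<open>The exponent is countable, so a point of the cube is determined by a sequence of numbers.\<close>
  moreover have "inj_on (\<lambda>x k. real (h x (prod_decode k))) (cube r)"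
  proof (rule inj_onI)
    fix x y assume xy: "x \<in> cube r" "y \<in> cube r"
      and eq: "(\<lambda>k. real (h x (prod_decode k))) = (\<lambda>k. real (h y (prod_decode k)))"
    have "h x p = h y p" for p using fun_cong[OF eq, of "prod_encode p"] by simp
    then have "h x = h y" by blast
    then show "x = y" using bij xy by (auto simp: bij_betw_def inj_on_def)
  qed
  ultimately show ?thesis
    unfolding H_space_eq_increasing_space by (rule subspace_of_image_increasing_space)
qed

end
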